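(* Every cyclic bigraph is gapful.
   Context: A bigraph $H=([n],[m],E)$ has left part $[n]$, right part $[m]$, edges $E\subseteq[n]\times[m]$, neighborhoods $\mathcal N_H(\cdot)$; its base graph $G_H$ is the graph on $[n]$ where distinct $u,v$ are adjacent iff they share a neighbor in $H$. $H$ is cyclic ($n$-cyclic) if $G_H$ is a cycle of length $n\ge3$; when $n=3$ one additionally requires $\bigcap_{i\in[n]}\mathcal N_H(i)=\emptyset$. Equip $[0,1]^m$ with Lebesgue measure $\mu$. A family $\mathcal A=\{A_1,\dots,A_n\}$ of measurable subsets of $[0,1]^m$ conforms with $H$ ($\mathcal A\sim H$) if each $A_i=B_i\times[0,1]^{[m]\setminus\mathcal N_H(i)}$ with $B_i\subseteq[0,1]^{\mathcal N_H(i)}$ measurable. The interior $\mathcal I(H)$ is the set of $\vec p\in(0,1)^n$ such that $\mu(\bigcap_i([0,1]^m\setminus A_i))>0$ for every $\mathcal A\sim H$ with $\mu(A_i)=p_i$ for all $i$. For a graph $G$ on $[n]$, the abstract interior $\mathcal I_a(G)$ is the set of $\vec p\in(0,1)^n$ such that for every probability space and events $A_1,\dots,A_n$ with $\Pr(A_i)=p_i$ for which $G$ is a dependency graph (each $A_i$ mutually independent of $\{A_j:j\ne i, j\notin\mathcal N_G(i)\}$), $\Pr(\bigcap_i\overline{A_i})>0$. $H$ is gapful in the direction of $\vec p\in(0,1)^n$ if there is $\lambda>0$ with $\lambda\vec p\in\mathcal I(H)\setminus\mathcal I_a(G_H)$; $H$ is gapful if it is gapful in some direction, and gapless otherwise.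 *)

theory Defs
  imports "HOL-Probability.Probability"
begin

text \<open>
  A bigraph is given by \<open>n\<close>, \<open>m\<close> and an edge set \<open>E \<subseteq> {1..n} \<times> {1..m}\<close>.
  A simple graph on \<open>{1..n}\<close> is given by its set of two-element edges.
  Vectors indexed by \<open>{1..n}\<close> are functions on \<open>nat\<close>; every notion below only
  depends on their values on \<open>{1..n}\<close>.
\<close>

definition bigraph :: "nat \<Rightarrow> nat \<Rightarrow> (nat \<times> nat) set \<Rightarrow> bool" where
  "bigraph n m E \<longleftrightarrow> E \<subseteq> {1..n} \<times> {1..m}"

definition left_nbhd :: "(nat \<times> nat) set \<Rightarrow> nat \<Rightarrow> nat set" where
  "left_nbhd E i = {j. (i, j) \<in> E}"

definition base_graph :: "nat \<Rightarrow> (nat \<times> nat) set \<Rightarrow> nat set set" where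
  "base_graph n E = {{u, v} | u v. u \<in> {1..n} \<and> v \<in> {1..n} \<and> u \<noteq> v \<and>
     left_nbhd E u \<inter> left_nbhd E v \<noteq> {}}"

definition is_cycle_graph :: "nat \<Rightarrow> nat set set \<Rightarrow> bool" where
  "is_cycle_graph n G \<longleftrightarrow> n \<ge> 3 \<and>
     (\<exists>\<sigma>. bij_betw \<sigma> {..<n} {1..n} \<and> G = {{\<sigma> k, \<sigma> ((k + 1) mod n)} | k. k < n})"

definition cyclic_bigraph :: "nat \<Rightarrow> nat \<Rightarrow> (nat \<times> nat) set \<Rightarrow> bool" where
  "cyclic_bigraph n m E \<longleftrightarrow> bigraph n m E \<and> is_cycle_graph n (base_graph n E) \<and>
     (n = 3 \<longrightarrow> (\<Inter>i\<in>{1..n}. left_nbhd E i) = {})"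

abbreviation unit_lborel :: "real measure" where
  "unit_lborel \<equiv> restrict_space lborel {0..1}"

text \<open>
  Lebesgue measure on \<open>[0,1]\<^sup>I\<close> for finite \<open>I\<close>. The completion makes exactly the
  Lebesgue measurable sets (and not just the Borel sets) measurable.
\<close>

definition unit_cube :: "nat set \<Rightarrow> (nat \<Rightarrow> real) measure" where
  "unit_cube I = completion (Pi\<^sub>M I (\<lambda>_. unit_lborel))"

text \<open>
  \<open>prod_emb {1..m} _ J B\<close> is the cylinder \<open>B \<times> [0,1]\<^bsup>{1..m} - J\<^esup>\<close>.
\<close>

definition conforms :: "nat \<Rightarrow> nat \<Rightarrow> (nat \<times> nat) set \<Rightarrow> (nat \<Rightarrow> (nat \<Rightarrow> real) set) \<Rightarrow> bool" where
  "conforms n m E A \<longleftrightarrow> (\<forall>i\<in>{1..n}. \<exists>B \<in> sets (unit_cube (left_nbhd E i)).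
     A i = prod_emb {1..m} (\<lambda>_. unit_lborel) (left_nbhd E i) B)"

definition interior_bigraph :: "nat \<Rightarrow> nat \<Rightarrow> (nat \<times> nat) set \<Rightarrow> (nat \<Rightarrow> real) set" where
  "interior_bigraph n m E = {p \<in> {1..n} \<rightarrow> {0<..<1}.
     \<forall>A. conforms n m E A \<and> (\<forall>i\<in>{1..n}. measure (unit_cube {1..m}) (A i) = p i) \<longrightarrow>
       measure (unit_cube {1..m}) (space (unit_cube {1..m}) - (\<Union>i\<in>{1..n}. A i)) > 0}"

text \<open>
  Mutual independence of an event from a family of events is independence from
  the \<open>\<sigma>\<close>-algebra generated by the family.
\<close>

definition dependency_graph :: "'a measure \<Rightarrow> nat \<Rightarrow> nat set set \<Rightarrow> (nat \<Rightarrow> 'a set) \<Rightarrow> bool" where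
  "dependency_graph M n G A \<longleftrightarrow> (\<forall>i\<in>{1..n}. prob_space.indep_set M {A i}
     (sigma_sets (space M) (A ` {j \<in> {1..n}. j \<noteq> i \<and> {i, j} \<notin> G})))"

definition abstract_lll :: "'a measure \<Rightarrow> nat \<Rightarrow> nat set set \<Rightarrow> (nat \<Rightarrow> real) \<Rightarrow> bool" where
  "abstract_lll M n G p \<longleftrightarrow> (\<forall>A. (\<forall>i\<in>{1..n}. A i \<in> sets M \<and> measure M (A i) = p i) \<and>
     dependency_graph M n G A \<longrightarrow> measure M (space M - (\<Union>i\<in>{1..n}. A i)) > 0)"

text \<open>
  HOL cannot quantify over all types inside a definition, so the probability spaces
  range over those with outcomes of type \<open>nat set\<close>. Nothing is lost: an outcome may be
  replaced by the set of (indices of) events it belongs to. The lemma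
  \<open>abstract_interior_iff\<close> below shows that membership is equivalent to the condition
  for all probability spaces on an arbitrary type together with those on \<open>nat set\<close>.
\<close>

definition abstract_interior :: "nat \<Rightarrow> nat set set \<Rightarrow> (nat \<Rightarrow> real) set" where
  "abstract_interior n G = {p \<in> {1..n} \<rightarrow> {0<..<1}.
     \<forall>M :: nat set measure. prob_space M \<longrightarrow> abstract_lll M n G p}"

definition gapful_in_direction ::
    "nat \<Rightarrow> nat \<Rightarrow> (nat \<times> nat) set \<Rightarrow> (nat \<Rightarrow> real) \<Rightarrow> bool" where
  "gapful_in_direction n m E p \<longleftrightarrow> p \<in> {1..n} \<rightarrow> {0<..<1} \<and>
     (\<exists>c>0. (\<lambda>i. c * p i) \<in> interior_bigraph n m E - abstract_interior n (base_graph n E))"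

definition gapful :: "nat \<Rightarrow> nat \<Rightarrow> (nat \<times> nat) set \<Rightarrow> bool" where
  "gapful n m E \<longleftrightarrow> (\<exists>p. gapful_in_direction n m E p)"

lemma abstract_interior_any_space:
  fixes M :: "'a measure"
  assumes p: "p \<in> abstract_interior n G" and M: "prob_space M"
  shows "abstract_lll M n G p"
  unfolding abstract_lll_def
proof (intro allI impI, elim conjE)
  fix A :: "nat \<Rightarrow> 'a set"
  assume A: "\<forall>i\<in>{1..n}. A i \<in> sets M \<and> measure M (A i) = p i"
    and dep: "dependency_graph M n G A"
  interpret M: prob_space M by (rule M)
  define f where "f x = {i \<in> {1..n}. x \<in> A i}" for x
  define C where "C = count_space (Pow {1..n})"
  define N where "N = distr M C f"
  define B where "B i = {S \<in> Pow {1..n}. i \<in> S}" for i :: nat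
  have fin: "finite (Pow {1..n})" by simp
  have pre: "f -` {S} \<inter> space M \<in> sets M" if S: "S \<in> Pow {1..n}" for S
  proof -
    have "f -` {S} \<inter> space M = {x \<in> space M. \<forall>i\<in>{1..n}. x \<in> A i \<longleftrightarrow> i \<in> S}"
    proof -
      have "f x = S \<longleftrightarrow> (\<forall>i\<in>{1..n}. x \<in> A i \<longleftrightarrow> i \<in> S)" for x
        using S unfolding f_def by blast
      thus ?thesis by blast
    qed
    also have "\<dots> \<in> sets M"
    proof (rule sets.sets_Collect_finite_All)
      fix i assume i: "i \<in> {1..n}"
      hence "A i \<in> sets M" using A by blast
      moreover have "{x \<in> space M. x \<in> A i \<longleftrightarrow> i \<in> S} = (if i \<in> S then A i else space M - A i)"
        using sets.sets_into_space[OF \<open>A i \<in> sets M\<close>] by auto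
      ultimately show "{x \<in> space M. x \<in> A i \<longleftrightarrow> i \<in> S} \<in> sets M" by simp
    qed simp
    finally show ?thesis .
  qed
  have f: "f \<in> measurable M C"
    unfolding C_def by (subst measurable_count_space_eq2[OF fin]) (use pre in \<open>auto simp: f_def\<close>)
  have N: "prob_space N" unfolding N_def by (rule M.prob_space_distr[OF f])
  interpret N: prob_space N by (rule N)
  have spN: "space N = Pow {1..n}" and setsN: "sets N = Pow (Pow {1..n})"
    by (auto simp: N_def C_def)
  have fsp: "f \<in> space M \<rightarrow> Pow {1..n}" by (auto simp: f_def)
  have meas: "measure N X = measure M (f -` X \<inter> space M)" if "X \<in> sets N" for X
    using that unfolding N_def by (subst measure_distr[OF f]) auto
  have vim: "f -` B i \<inter> space M = A i" if "i \<in> {1..n}" for i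
    using A that sets.sets_into_space[of "A i" M] by (auto simp: f_def B_def)
  have Bs: "B i \<in> sets N" for i by (auto simp: setsN B_def)
  have 1: "\<forall>i\<in>{1..n}. B i \<in> sets N \<and> measure N (B i) = p i"
    using A Bs by (simp add: meas vim)
  have 2: "dependency_graph N n G B"
    unfolding dependency_graph_def
  proof
    fix i assume i: "i \<in> {1..n}"
    define J where "J = {j \<in> {1..n}. j \<noteq> i \<and> {i, j} \<notin> G}"
    have ind: "M.indep_set {A i} (sigma_sets (space M) (A ` J))"
      using dep i unfolding dependency_graph_def J_def by blast
    have vs: "f -` X \<inter> space M \<in> sigma_sets (space M) (A ` J)"
      if "X \<in> sigma_sets (space N) (B ` J)" for X
    proof -
      have "{f -` X \<inter> space M | X. X \<in> sigma_sets (space N) (B ` J)} =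
            sigma_sets (space M) {f -` X \<inter> space M | X. X \<in> B ` J}"
        by (rule sigma_sets_vimage_commute) (use fsp spN in auto)
      also have "{f -` X \<inter> space M | X. X \<in> B ` J} = (\<lambda>j. f -` B j \<inter> space M) ` J" by auto
      also have "\<dots> = A ` J" by (rule image_cong) (auto simp: J_def vim)
      finally show ?thesis using that by blast
    qed
    have sub: "sigma_sets (space N) (B ` J) \<subseteq> sets N"
      by (rule sets.sigma_sets_subset) (use Bs in auto)
    have "N.indep_set {B i} (sigma_sets (space N) (B ` J))"
      unfolding N.indep_sets2_eq
    proof (intro conjI ballI)
      show "{B i} \<subseteq> N.events" using Bs by simp
      show "sigma_sets (space N) (B ` J) \<subseteq> N.events" by (rule sub)
      fix a b assume ab: "a \<in> {B i}" "b \<in> sigma_sets (space N) (B ` J)"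
      have bN: "b \<in> sets N" using ab sub by blast
      have "N.prob (a \<inter> b) = M.prob (f -` (B i \<inter> b) \<inter> space M)"
        using ab bN Bs by (subst meas) auto
      also have "f -` (B i \<inter> b) \<inter> space M = A i \<inter> (f -` b \<inter> space M)"
        using vim[OF i] by auto
      also have "M.prob \<dots> = M.prob (A i) * M.prob (f -` b \<inter> space M)"
        using ind vs[OF ab(2)] unfolding M.indep_sets2_eq by blast
      also have "\<dots> = N.prob a * N.prob b"
        using ab bN Bs i by (simp add: meas vim)
      finally show "N.prob (a \<inter> b) = N.prob a * N.prob b" .
    qed
    thus "N.indep_set {B i} (sigma_sets (space N) (B ` {j \<in> {1..n}. j \<noteq> i \<and> {i, j} \<notin> G}))"
      unfolding J_def .
  qed
  have "measure N (space N - (\<Union>i\<in>{1..n}. B i)) > 0"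
    using p N 1 2 unfolding abstract_interior_def abstract_lll_def by blast
  also have "measure N (space N - (\<Union>i\<in>{1..n}. B i)) =
             measure M (f -` (space N - (\<Union>i\<in>{1..n}. B i)) \<inter> space M)"
    by (rule meas) (auto simp: setsN spN)
  also have "f -` (space N - (\<Union>i\<in>{1..n}. B i)) \<inter> space M = space M - (\<Union>i\<in>{1..n}. A i)"
    using vim fsp spN by (auto simp: f_def B_def)
  finally show "measure M (space M - (\<Union>i\<in>{1..n}. A i)) > 0" .
qed

lemma abstract_interior_iff:
  "p \<in> abstract_interior n G \<longleftrightarrow> p \<in> {1..n} \<rightarrow> {0<..<1} \<and>
     (\<forall>M :: nat set measure. prob_space M \<longrightarrow> abstract_lll M n G p) \<and>
     (\<forall>M :: 'a measure. prob_space M \<longrightarrow> abstract_lll M n G p)"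
  using abstract_interior_any_space[of p n G] unfolding abstract_interior_def by auto

end

theory Submission
  imports Defs
begin

text \<open>
  The gap is witnessed on the boundary of Shearer's region: all probabilities are equal to
  \<open>p = 1 / (4 cos\<^sup>2 (\<pi> / 2n))\<close>, the smallest \<open>p > 0\<close> such that the independence
  polynomial of the cycle vanishes at \<open>- p\<close>. Shearer's extremal probability space, whose atoms are the independent sets, covers
  everything, so the constant vector \<open>p\<close> is not in the abstract interior. Conversely, a
  family that covers everything at this vector must attain equality throughout Shearer's
  estimate, so adjacent events are almost disjoint. If adjacent events \<open>A\<^sub>k\<close>,
  \<open>A\<^sub>k\<^sub>+\<^sub>1\<close> of a conforming family are almost disjoint, they are separated by an
  event \<open>S\<^sub>k\<close> of positive probability in their common variables that almost excludes
  \<open>A\<^sub>k\<^sub>+\<^sub>1\<close>. The common variables of different adjacent pairs are disjoint, so the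
  \<open>S\<^sub>k\<close> are independent and hold simultaneously with positive probability; but then almost
  surely no \<open>A\<^sub>k\<close> occurs.
\<close>

section \<open>Cycles\<close>

text \<open>Exposes the enumeration that \<open>is_cycle_graph\<close> hides behind a quantifier; it
  can then be rotated to put a chosen vertex or edge at a prescribed position.\<close>

definition cycle_order :: "nat \<Rightarrow> nat set set \<Rightarrow> (nat \<Rightarrow> nat) \<Rightarrow> bool" where
  "cycle_order n G \<sigma> \<longleftrightarrow> n \<ge> 3 \<and> bij_betw \<sigma> {..<n} {1..n} \<and> G = {{\<sigma> k, \<sigma> ((k + 1) mod n)} | k. k < n}"

lemma is_cycle_graph_iff_cycle_order: "is_cycle_graph n G \<longleftrightarrow> (\<exists>\<sigma>. cycle_order n G \<sigma>)"
  by (auto simp: is_cycle_graph_def cycle_order_def)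

lemma bij_betw_rotate_mod:
  assumes "n > (0::nat)"
  shows "bij_betw (\<lambda>k. (k + i) mod n) {..<n} {..<n}"
proof -
  have "b \<in> (\<lambda>k. (k + i) mod n) ` {..<n}" if "b < n" for b
  proof (rule image_eqI)
    \<comment> \<open>The preimage of \<open>b\<close> is \<open>b - i\<close> modulo
      \<open>n\<close>; on the naturals \<open>n - i mod n\<close> stands in for
      \<open>- i\<close>.\<close>
    have "((b + (n - i mod n)) mod n + i) mod n = (b + (n - i mod n) + i mod n) mod n"
      by (simp only: mod_add_left_eq mod_add_right_eq)
    also have "b + (n - i mod n) + i mod n = b + n" using mod_less_divisor[of n i] assms by linarith
    finally show "b = ((b + (n - i mod n)) mod n + i) mod n" using that by simp
  qed (use assms in simp)
  hence "(\<lambda>k. (k + i) mod n) ` {..<n} = {..<n}" using assms by auto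
  thus ?thesis by (simp add: bij_betw_def eq_card_imp_inj_on)
qed

lemma cycle_order_rotate:
  assumes "cycle_order n G \<sigma>"
  shows "cycle_order n G (\<lambda>k. \<sigma> ((k + i) mod n))"
proof -
  have n: "n \<ge> 3" and b: "bij_betw \<sigma> {..<n} {1..n}" and G: "G = (\<lambda>k. {\<sigma> k, \<sigma> ((k + 1) mod n)}) ` {..<n}"
    using assms by (auto simp: cycle_order_def)
  have r: "bij_betw (\<lambda>k. (k + i) mod n) {..<n} {..<n}" using n by (intro bij_betw_rotate_mod) simp
  have "G = (\<lambda>k. {\<sigma> k, \<sigma> ((k + 1) mod n)}) ` ((\<lambda>k. (k + i) mod n) ` {..<n})"
    using r G by (simp add: bij_betw_def)
  also have "\<dots> = (\<lambda>k. {\<sigma> ((k + i) mod n), \<sigma> (((k + 1) mod n + i) mod n)}) ` {..<n}"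
    unfolding image_image by (simp add: mod_simps algebra_simps)
  finally show ?thesis
    using n bij_betw_trans[OF r b] by (auto simp: cycle_order_def o_def)
qed

lemma cycle_order_inj:
  "cycle_order n G \<sigma> \<Longrightarrow> a < n \<Longrightarrow> b < n \<Longrightarrow> \<sigma> a = \<sigma> b \<longleftrightarrow> a = b"
  by (auto simp: cycle_order_def bij_betw_def inj_on_def)

lemma cycle_order_edge_iff:
  assumes "cycle_order n G \<sigma>" "a < n" "b < n"
  shows "{\<sigma> a, \<sigma> b} \<in> G \<longleftrightarrow> b = (a + 1) mod n \<or> a = (b + 1) mod n"
proof -
  have G: "G = {{\<sigma> k, \<sigma> ((k + 1) mod n)} | k. k < n}" and n: "n \<ge> 3"
    using assms(1) by (auto simp: cycle_order_def)
  have "{\<sigma> a, \<sigma> b} = {\<sigma> k, \<sigma> ((k + 1) mod n)} \<longleftrightarrow>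
        a = k \<and> b = (k + 1) mod n \<or> a = (k + 1) mod n \<and> b = k" if "k < n" for k
    using cycle_order_inj[OF assms(1)] assms(2,3) that n
    by (auto simp: doubleton_eq_iff)
  thus ?thesis unfolding G using assms(2,3) by auto
qed

lemma cycle_order_edge_less_iff:
  assumes "cycle_order n G \<sigma>" "a < b" "b < n"
  shows "{\<sigma> a, \<sigma> b} \<in> G \<longleftrightarrow> b = a + 1 \<or> a = 0 \<and> b = n - 1"
proof -
  have "(a + 1) mod n = a + 1" using assms by simp
  moreover have "a = (b + 1) mod n \<longleftrightarrow> a = 0 \<and> b = n - 1"
    using assms(2,3) by (cases "b + 1 = n") auto
  ultimately show ?thesis
    using assms by (subst cycle_order_edge_iff[OF assms(1)]) auto
qed

text \<open>\<open>f k\<close> is the independence polynomial of the path on \<open>k\<close> vertices at \<open>- p\<close>; the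
  equation \<open>f (n - 1) = p * f (n - 3)\<close> says that the one of the \<open>n\<close>-cycle vanishes there.\<close>

definition shearer_point :: "nat \<Rightarrow> real \<Rightarrow> (nat \<Rightarrow> real) \<Rightarrow> bool" where
  "shearer_point n p f \<longleftrightarrow> n \<ge> 3 \<and> 0 < p \<and> p < 1 \<and> f 0 = 1 \<and> f 1 = 1 - p \<and>
     (\<forall>k. f (k + 2) = f (k + 1) - p * f k) \<and> (\<forall>k<n. f k > 0) \<and> f (n - 1) = p * f (n - 3)"

text \<open>Up to powers of \<open>c\<close>, the recursion is the identity sin((k+2)t) + sin(kt) =
  2 cos(t) sin((k+1)t). The angle \<open>t\<close> is chosen so that the arguments (n+1)t of
  \<open>f (n - 1)\<close> and (n-1)t of \<open>f (n - 3)\<close> add up to pi and have equal sines.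
  For \<open>k < n\<close> the argument lies strictly between 0 and pi, which gives
  positivity.\<close>

lemma shearer_point_exists:
  assumes "n \<ge> 3"
  shows "\<exists>p f. shearer_point n p f"
proof -
  define t where "t = pi / (2 * real n)"
  define c where "c = 2 * cos t"
  define p where "p = 1 / c\<^sup>2"
  define f where "f k = sin (real (k + 2) * t) / (c ^ (k + 1) * sin t)" for k
  have tn: "2 * real n * t = pi" and t0: "0 < t" using assms by (auto simp: t_def)
  have "t < pi / 2" using assms t0 by (simp add: t_def field_simps)
  hence c0: "c > 0" and s0: "sin t > 0"
    using t0 pi_gt_zero by (auto simp: c_def intro!: cos_gt_zero sin_gt_zero)
  have rec: "sin (real (k + 2) * t) = c * sin (real (k + 1) * t) - sin (real k * t)" for k
  proof -
    have "sin (real (k + 2) * t) + sin (real k * t) = 2 * sin (real (k + 1) * t) * cos t"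
    proof -
      have "(real (k + 2) * t + real k * t) / 2 = real (k + 1) * t"
        and "(real (k + 2) * t - real k * t) / 2 = t" by (simp_all add: field_simps)
      thus ?thesis using sin_plus_sin[of "real (k + 2) * t" "real k * t"] by (simp only:)
    qed
    thus ?thesis unfolding c_def by (simp only: eq_diff_eq mult_ac)
  qed
  have f0: "f 0 = 1" using s0 c0 by (simp add: f_def sin_double c_def)
  have f1: "f 1 = 1 - p"
    using s0 c0 rec[of 1] sin_double[of t]
    by (simp add: f_def p_def c_def field_simps power2_eq_square numeral_eq_Suc)
  have frec: "f (k + 2) = f (k + 1) - p * f k" for k
    unfolding f_def using rec[of "k + 2"] c0 s0
    by (simp add: p_def field_simps power2_eq_square)
  have fpos: "f k > 0" if "k < n" for k
  proof -
    have "real (k + 2) < 2 * real n" using that assms by linarith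
    hence "real (k + 2) * t < pi" using t0 tn by (metis mult_strict_right_mono)
    thus ?thesis using t0 s0 c0 by (auto simp: f_def intro!: divide_pos_pos sin_gt_zero)
  qed
  have "f (n - 1) = p * f (n - 3)"
  proof -
    obtain k where k: "n = k + 3" using assms by (metis add.commute le_Suc_ex)
    have "sin (real (k + 4) * t) = sin (real (k + 2) * t)"
    proof -
      have "real (k + 4) * t = pi - real (k + 2) * t" using tn k by (simp add: algebra_simps)
      thus ?thesis by simp
    qed
    thus ?thesis using c0 s0 by (simp add: k f_def p_def field_simps power2_eq_square)
  qed
  moreover have "p > 0" using c0 by (simp add: p_def)
  moreover have "p < 1" using fpos[of 1] f1 assms by simp
  ultimately have "shearer_point n p f"
    using assms f0 f1 frec fpos by (auto simp: shearer_point_def)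
  thus ?thesis by blast
qed

section \<open>Shearer's estimate for paths and cycles\<close>

context prob_space begin

definition avoid :: "(nat \<Rightarrow> 'a set) \<Rightarrow> nat set \<Rightarrow> 'a set" where
  "avoid A T = space M - (\<Union>j\<in>T. A j)"

lemma avoid_insert: "avoid A (insert k T) = avoid A T - A k"
  by (auto simp: avoid_def)

lemma avoid_sets: "finite T \<Longrightarrow> (\<And>j. j \<in> T \<Longrightarrow> A j \<in> events) \<Longrightarrow> avoid A T \<in> events"
  by (auto simp: avoid_def)

lemma prob_avoid_insert:
  assumes "finite T" "\<And>j. j \<in> T \<Longrightarrow> A j \<in> events" "A k \<in> events"
  shows "prob (avoid A (insert k T)) = prob (avoid A T) - prob (A k \<inter> avoid A T)"
  unfolding avoid_insert
  by (subst finite_measure_Diff') (use assms avoid_sets in \<open>auto simp: Int_commute\<close>)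

text \<open>Let D k be \<open>f k * prob (avoid B {..<k+1}) - f (k+1) * prob (avoid B
  {..<k})\<close>, the excess of the ratio of consecutive avoidance probabilities over
  \<open>f (k+1) / f k\<close>, with denominators cleared. Each step multiplies D by
  \<open>p\<close> and adds a multiple of the overlap of adjacent events: \<open>B (k+1)\<close>
  takes the fraction \<open>p\<close> of \<open>avoid B {..<k}\<close>, but its part inside
  \<open>B k\<close> is already gone. Truncated subtraction makes \<open>ind\<close> at 0 say that
  \<open>B 0\<close> has probability \<open>p\<close>.\<close>

lemma path_avoid_step:
  assumes ev: "\<And>k. k < N \<Longrightarrow> B k \<in> events"
    and ind: "\<And>k. k < N \<Longrightarrow> prob (B k \<inter> avoid B {..<k-1}) = p * prob (avoid B {..<k-1})"
    and sp: "shearer_point n p f" and k: "k + 1 < N"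
  shows "f (k+1) * prob (avoid B {..<k+2}) - f (k+2) * prob (avoid B {..<k+1}) =
    p * (f k * prob (avoid B {..<k+1}) - f (k+1) * prob (avoid B {..<k})) +
    f (k+1) * prob (B k \<inter> B (k+1) \<inter> avoid B {..<k})"
proof -
  have alg: "f1 * g2 - f2 * g1 = p * (f0 * g1 - f1 * g0) + f1 * d"
    if "g2 = g1 - x" "x = y - d" "y = p * g0" "f2 = f1 - p * f0" for g0 g1 g2 f0 f1 f2 x y d :: real
    unfolding that by (simp add: algebra_simps)
  have ins: "{..<k+1} = insert k {..<k}" "{..<k+2} = insert (k+1) {..<k+1}" by auto
  have av: "avoid B {..<k} \<in> events" "avoid B {..<k+1} \<in> events"
    using ev k by (auto intro!: avoid_sets)
  have "prob (avoid B {..<k+2}) = prob (avoid B {..<k+1}) - prob (B (k+1) \<inter> avoid B {..<k+1})"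
    unfolding ins(2) by (rule prob_avoid_insert) (use ev k in auto)
  moreover have "prob (B (k+1) \<inter> avoid B {..<k+1}) =
      prob (B (k+1) \<inter> avoid B {..<k}) - prob (B k \<inter> B (k+1) \<inter> avoid B {..<k})"
  proof -
    have "B (k+1) \<inter> avoid B {..<k+1} = B (k+1) \<inter> avoid B {..<k} - B k \<inter> B (k+1) \<inter> avoid B {..<k}"
      unfolding ins(1) avoid_insert by auto
    thus ?thesis using ev[of k] ev[of "k+1"] av k
      by (simp only:) (intro finite_measure_Diff, auto)
  qed
  moreover have "prob (B (k+1) \<inter> avoid B {..<k}) = p * prob (avoid B {..<k})"
    using ind[of "k+1"] k by simp
  moreover have "f (k+2) = f (k+1) - p * f k" using sp by (simp add: shearer_point_def)
  ultimately show ?thesis by (rule alg)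
qed

text \<open>The excess starts at zero because \<open>f 1 / f 0 = 1 - p\<close>.\<close>

lemma path_avoid_base:
  assumes "B 0 \<in> events" "prob (B 0) = p" "shearer_point n p f"
  shows "f 0 * prob (avoid B {..<1}) - f 1 * prob (avoid B {..<0}) = 0"
proof -
  have "{..<Suc 0} = insert 0 {}" by auto
  hence "prob (avoid B {..<1}) = prob (space M) - prob (B 0)"
    using prob_avoid_insert[of "{}" B 0] assms(1) sets.sets_into_space[OF assms(1)]
    by (simp add: avoid_def Int_absorb2)
  thus ?thesis using assms by (simp add: shearer_point_def avoid_def prob_space)
qed

text \<open>Induction on the excess \<open>?D\<close> through \<open>path_avoid_step\<close>. All
  terms added are nonnegative; an overlap of \<open>B 0\<close> and \<open>B 1\<close> makes
  \<open>?D 1\<close> positive, and the factor \<open>p > 0\<close> carries positivity to all later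
  indices.\<close>

lemma path_avoid_ratio:
  assumes ev: "\<And>k. k < N \<Longrightarrow> B k \<in> events"
    and ind: "\<And>k. k < N \<Longrightarrow> prob (B k \<inter> avoid B {..<k-1}) = p * prob (avoid B {..<k-1})"
    and sp: "shearer_point n p f" and "N \<le> n"
  shows "k < N \<Longrightarrow> f (k+1) * prob (avoid B {..<k}) \<le> f k * prob (avoid B {..<k+1})"
    and "prob (B 0 \<inter> B 1) > 0 \<Longrightarrow> k + 1 < N \<Longrightarrow>
      f (k+2) * prob (avoid B {..<k+1}) < f (k+1) * prob (avoid B {..<k+2})"
proof -
  let ?D = "\<lambda>k. f k * prob (avoid B {..<k+1}) - f (k+1) * prob (avoid B {..<k})"
  have p: "p > 0" and f: "\<And>k. k < n \<Longrightarrow> f k > 0" using sp by (auto simp: shearer_point_def)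
  have step: "?D (k+1) = p * ?D k + f (k+1) * prob (B k \<inter> B (k+1) \<inter> avoid B {..<k})"
    if "k + 1 < N" for k
    using path_avoid_step[OF ev ind sp that] by (simp add: add.assoc)
  have 0: "?D 0 = 0" if "N > 0"
    using path_avoid_base[OF _ _ sp, of B] ev[of 0] ind[of 0] that sets.sets_into_space[of "B 0" M]
    by (simp add: avoid_def prob_space Int_absorb2)
  show "f (k+1) * prob (avoid B {..<k}) \<le> f k * prob (avoid B {..<k+1})" if "k < N"
  proof -
    have "?D k \<ge> 0" using that
    proof (induction k)
      case (Suc k)
      have "0 \<le> p * ?D k + f (k+1) * prob (B k \<inter> B (k+1) \<inter> avoid B {..<k})"
        using Suc p f[of "k+1"] \<open>N \<le> n\<close> by (intro add_nonneg_nonneg mult_nonneg_nonneg) auto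
      also have "\<dots> = ?D (k+1)" using step[of k] Suc by simp
      finally show ?case by simp
    qed (use 0 in simp)
    thus ?thesis by simp
  qed
  show "f (k+2) * prob (avoid B {..<k+1}) < f (k+1) * prob (avoid B {..<k+2})"
    if pos: "prob (B 0 \<inter> B 1) > 0" and k: "k + 1 < N"
  proof -
    have "?D (k+1) > 0" using k
    proof (induction k)
      case 0
      have "B 0 \<inter> B 1 \<inter> avoid B {..<0} = B 0 \<inter> B 1"
        using ev[of 0] 0 sets.sets_into_space[of "B 0" M] by (auto simp: avoid_def)
      hence "?D 1 = f 1 * prob (B 0 \<inter> B 1)" using step[of 0] \<open>N > 0 \<Longrightarrow> ?D 0 = 0\<close> 0 by simp
      also have "\<dots> > 0" using f[of 1] pos 0 \<open>N \<le> n\<close> by simp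
      finally show ?case by simp
    next
      case (Suc k)
      have "0 < p * ?D (k+1) + f (k+2) * prob (B (k+1) \<inter> B (k+2) \<inter> avoid B {..<k+1})"
        using Suc p f[of "k+2"] \<open>N \<le> n\<close> by (intro add_pos_nonneg mult_pos_pos mult_nonneg_nonneg) auto
      also have "\<dots> = ?D (k+2)" using step[of "k+1"] Suc by (simp add: add.assoc)
      finally show ?case by simp
    qed
    thus ?thesis by (simp add: add.assoc)
  qed
qed

text \<open>The last vertex, \<open>m + 2\<close> in the proof, has the neighbours \<open>0\<close>
  and \<open>m + 1\<close>. Dropping these two from the avoided events gives independence, so it is
  enough that \<open>p * prob (avoid A {1..<m+1}) < prob (avoid A {..<m+2})\<close>. Both sides are
  compared with \<open>prob (avoid A {..<m+1})\<close>: a forward path estimate is strict by the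
  overlap of \<open>A 0\<close> and \<open>A 1\<close>, a backward one need not be, and
  \<open>f (n - 1) = p * f (n - 3)\<close> links the two.\<close>

lemma cycle_avoid_pos:
  assumes ev: "\<And>k. k < n \<Longrightarrow> A k \<in> events"
    and ind: "\<And>k T. k < n \<Longrightarrow> T \<subseteq> {..<n} \<Longrightarrow>
      (\<And>j. j \<in> T \<Longrightarrow> j \<noteq> k \<and> j \<noteq> (k + 1) mod n \<and> k \<noteq> (j + 1) mod n) \<Longrightarrow>
      prob (A k \<inter> avoid A T) = p * prob (avoid A T)"
    and sp: "shearer_point n p f" and pos: "prob (A 0 \<inter> A 1) > 0"
  shows "prob (avoid A {..<n}) > 0"
proof -
  have n: "n \<ge> 3" and p: "p > 0" and f: "\<And>k. k < n \<Longrightarrow> f k > 0" and fn: "f (n - 1) = p * f (n - 3)"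
    using sp by (auto simp: shearer_point_def)
  obtain m where m: "n = m + 3" using n by (metis add.commute le_Suc_ex)
  have "prob (A k \<inter> avoid A {..<k-1}) = p * prob (avoid A {..<k-1})" if "k < n - 1" for k
    using that by (intro ind) auto
  hence 1: "f (m + 2) * prob (avoid A {..<m+1}) < f (m + 1) * prob (avoid A {..<m+2})"
    by (intro path_avoid_ratio(2)[OF _ _ sp, where N = "n - 1"]) (use pos ev in \<open>auto simp: m\<close>)
  \<comment> \<open>The path from \<open>m\<close> down to \<open>0\<close>, so that the vertex
    added last is \<open>0\<close>.\<close>
  define B where "B j = A (m - j)" for j
  have avB: "avoid B {..<k} = avoid A {m+1-k..<m+1}" if "k \<le> m + 1" for k
  proof -
    have "(\<Union>j<k. B j) = (\<Union>j\<in>{m+1-k..<m+1}. A j)"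
    proof -
      have "(\<lambda>j. m - j) ` {..<k} = {m+1-k..<m+1}"
      proof (intro equalityI subsetI)
        fix x assume "x \<in> {m+1-k..<m+1}"
        thus "x \<in> (\<lambda>j. m - j) ` {..<k}" by (intro image_eqI[of _ _ "m - x"]) auto
      qed (use that in auto)
      thus ?thesis unfolding B_def by (metis image_image)
    qed
    thus ?thesis by (simp add: avoid_def)
  qed
  have "prob (B k \<inter> avoid B {..<k-1}) = p * prob (avoid B {..<k-1})" if k: "k < m + 1" for k
  proof -
    have "prob (A (m - k) \<inter> avoid A {m+1-(k-1)..<m+1}) = p * prob (avoid A {m+1-(k-1)..<m+1})"
    proof (rule ind)
      fix j assume "j \<in> {m+1-(k-1)..<m+1}"
      thus "j \<noteq> m - k \<and> j \<noteq> (m - k + 1) mod n \<and> m - k \<noteq> (j + 1) mod n" using k by (auto simp: m)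
    qed (use k m in auto)
    thus ?thesis using avB[of "k - 1"] k by (simp add: B_def)
  qed
  hence "f (m + 1) * prob (avoid B {..<m}) \<le> f m * prob (avoid B {..<m+1})"
    by (intro path_avoid_ratio(1)[OF _ _ sp, where N = "m + 1"]) (use ev in \<open>auto simp: m B_def\<close>)
  hence 2: "f (m + 1) * prob (avoid A {1..<m+1}) \<le> f m * prob (avoid A {..<m+1})"
    using avB[of m] avB[of "m+1"] by (simp add: atLeast0LessThan)
  have "f (m + 1) * (p * prob (avoid A {1..<m+1})) \<le> p * (f m * prob (avoid A {..<m+1}))"
    using mult_left_mono[OF 2, of p] p by (simp add: algebra_simps)
  also have "\<dots> = f (m + 2) * prob (avoid A {..<m+1})" using fn by (simp add: m)
  also note 1
  finally have 3: "p * prob (avoid A {1..<m+1}) < prob (avoid A {..<m+2})"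
    using f[of "m+1"] by (simp add: m)
  have "prob (A (m+2) \<inter> avoid A {..<m+2}) \<le> prob (A (m+2) \<inter> avoid A {1..<m+1})"
    by (rule finite_measure_mono) (use ev in \<open>auto simp: avoid_def m intro!: sets.Int avoid_sets[unfolded avoid_def]\<close>)
  also have "\<dots> = p * prob (avoid A {1..<m+1})"
  proof (rule ind)
    fix j assume "j \<in> {1..<m+1}"
    moreover have "m + 2 + 1 = n" by (simp add: m)
    hence "(m + 2 + 1) mod n = 0" by (simp only: mod_self)
    ultimately show "j \<noteq> m + 2 \<and> j \<noteq> (m + 2 + 1) mod n \<and> m + 2 \<noteq> (j + 1) mod n" by (simp add: m)
  qed (use m in auto)
  finally have "prob (A (m+2) \<inter> avoid A {..<m+2}) < prob (avoid A {..<m+2})" using 3 by simp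
  moreover have "{..<n} = insert (m+2) {..<m+2}" by (auto simp: m)
  ultimately show ?thesis
    using prob_avoid_insert[of "{..<m+2}" A "m+2"] ev by (simp add: m)
qed

end

section \<open>Shearer's extremal probability space\<close>

definition indep_in :: "'a set set \<Rightarrow> 'a set \<Rightarrow> bool" where
  "indep_in G I \<longleftrightarrow> (\<forall>x\<in>I. \<forall>y\<in>I. {x, y} \<notin> G)"

text \<open>The independence polynomial of the subgraph induced on \<open>W\<close>, evaluated at
  \<open>- p\<close>.\<close>

definition indep_sum :: "'a set set \<Rightarrow> real \<Rightarrow> 'a set \<Rightarrow> real" where
  "indep_sum G p W = (\<Sum>I | I \<subseteq> W \<and> indep_in G I. (- p) ^ card I)"

lemma indep_sum_empty [simp]: "indep_sum G p {} = 1"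
proof -
  have "{I. I \<subseteq> {} \<and> indep_in G I} = {{}}" by (auto simp: indep_in_def)
  thus ?thesis by (simp add: indep_sum_def)
qed

lemma indep_in_Un:
  "indep_in G (S \<union> T) \<longleftrightarrow> indep_in G S \<and> indep_in G T \<and> (\<forall>s\<in>S. \<forall>t\<in>T. {s, t} \<notin> G)"
proof -
  have "{x, y} \<in> G \<longleftrightarrow> {y, x} \<in> G" for x y by (simp add: insert_commute)
  thus ?thesis unfolding indep_in_def by blast
qed

text \<open>Deletion recurrence: an independent set either avoids \<open>v\<close> or consists of
  \<open>v\<close> and an independent set of vertices not adjacent to \<open>v\<close>.\<close>

lemma indep_sum_insert:
  assumes "finite W" "v \<notin> W" "{v} \<notin> G"
  shows "indep_sum G p (insert v W) =
    indep_sum G p W - p * indep_sum G p {w \<in> W. {v, w} \<notin> G}"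
proof -
  let ?X = "{I. I \<subseteq> W \<and> indep_in G I}" and ?N = "{w \<in> W. {v, w} \<notin> G}"
  let ?Y = "{I. I \<subseteq> ?N \<and> indep_in G I}"
  have fin: "finite ?X" "finite ?Y" using assms(1) by (auto intro: finite_subset[of _ "Pow W"])
  have ins: "indep_in G (insert v J) \<longleftrightarrow> indep_in G J \<and> (\<forall>w\<in>J. {v, w} \<notin> G)" for J
    using indep_in_Un[of G "{v}" J] assms(3) by (auto simp: indep_in_def)
  have "{I. I \<subseteq> insert v W \<and> indep_in G I} = ?X \<union> insert v ` ?Y"
  proof (intro equalityI subsetI)
    fix I assume I: "I \<in> {I. I \<subseteq> insert v W \<and> indep_in G I}"
    show "I \<in> ?X \<union> insert v ` ?Y"
    proof (cases "v \<in> I")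
      case True
      hence eq: "I = insert v (I - {v})" by auto
      have "I - {v} \<in> ?Y" using I ins[of "I - {v}"] True by (auto simp: insert_absorb)
      thus ?thesis using eq by blast
    qed (use I in auto)
  next
    fix I assume "I \<in> ?X \<union> insert v ` ?Y"
    thus "I \<in> {I. I \<subseteq> insert v W \<and> indep_in G I}" by (auto simp: ins)
  qed
  moreover have "?X \<inter> insert v ` ?Y = {}" using assms(2) by auto
  ultimately have "indep_sum G p (insert v W) =
      indep_sum G p W + (\<Sum>I\<in>insert v ` ?Y. (- p) ^ card I)"
    unfolding indep_sum_def using fin by (simp add: sum.union_disjoint)
  also have "(\<Sum>I\<in>insert v ` ?Y. (- p) ^ card I) = (\<Sum>I\<in>?Y. (- p) ^ card (insert v I))"
    by (rule sum.reindex_cong[OF _ refl]) (use assms(2) in \<open>auto simp: inj_on_def insert_eq_iff\<close>)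
  also have "\<dots> = (\<Sum>I\<in>?Y. - p * (- p) ^ card I)"
  proof (rule sum.cong)
    fix I assume "I \<in> ?Y"
    hence "finite I" "v \<notin> I" using assms(1,2) by (auto intro: finite_subset)
    thus "(- p) ^ card (insert v I) = - p * (- p) ^ card I" by simp
  qed simp
  also have "\<dots> = - p * indep_sum G p ?N" by (simp add: indep_sum_def sum_distrib_left)
  finally show ?thesis by simp
qed

text \<open>Moebius inversion of the prescription that all events in \<open>U\<close> occur together
  with probability \<open>p ^ card U\<close> if \<open>U\<close> is independent and 0 otherwise. The
  result is the weight of the outcome in which exactly the events in \<open>T\<close> occur; in
  general it may be negative.\<close>

definition shearer_weight :: "'a set set \<Rightarrow> real \<Rightarrow> 'a set \<Rightarrow> 'a set \<Rightarrow> real" where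
  "shearer_weight G p V T =
     (\<Sum>U | U \<subseteq> V \<and> T \<subseteq> U. if indep_in G U then (-1) ^ card (U - T) * p ^ card U else 0)"

text \<open>The independent supersets of an independent \<open>T\<close> are the sets
  \<open>T \<union> I\<close> with \<open>I\<close> independent and free of neighbours of
  \<open>T\<close>; so \<open>p ^ card T\<close> factors out, and the signs combine into powers of
  \<open>- p\<close>.\<close>

lemma shearer_weight_eq:
  assumes V: "finite V" and T: "T \<subseteq> V"
  shows "shearer_weight G p V T = (if indep_in G T
    then p ^ card T * indep_sum G p {v \<in> V - T. \<forall>t\<in>T. {t, v} \<notin> G} else 0)"
proof (cases "indep_in G T")
  case True
  let ?R = "{v \<in> V - T. \<forall>t\<in>T. {t, v} \<notin> G}"
  let ?Y = "{I. I \<subseteq> ?R \<and> indep_in G I}"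
  let ?c = "\<lambda>U. (-1) ^ card (U - T) * p ^ card U :: real"
  have "shearer_weight G p V T = (\<Sum>U | (U \<subseteq> V \<and> T \<subseteq> U) \<and> indep_in G U. ?c U)"
  proof -
    have "finite {U. U \<subseteq> V \<and> T \<subseteq> U}" using V by (auto intro: finite_subset[of _ "Pow V"])
    from sum.inter_filter[OF this, of ?c "indep_in G"] show ?thesis by (simp add: shearer_weight_def)
  qed
  also have "{U. (U \<subseteq> V \<and> T \<subseteq> U) \<and> indep_in G U} = (\<union>) T ` ?Y"
  proof (intro equalityI subsetI)
    fix U assume U: "U \<in> {U. (U \<subseteq> V \<and> T \<subseteq> U) \<and> indep_in G U}"
    have "U - T \<in> ?Y" using U by (auto simp: indep_in_def)
    moreover have "U = T \<union> (U - T)" using U by auto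
    ultimately show "U \<in> (\<union>) T ` ?Y" by blast
  next
    fix U assume "U \<in> (\<union>) T ` ?Y"
    thus "U \<in> {U. (U \<subseteq> V \<and> T \<subseteq> U) \<and> indep_in G U}" using T True by (auto simp: indep_in_Un) blast
  qed
  also have "sum ?c \<dots> = (\<Sum>I\<in>?Y. ?c (T \<union> I))"
    by (rule sum.reindex_cong[OF _ refl]) (auto simp: inj_on_def)
  also have "\<dots> = (\<Sum>I\<in>?Y. p ^ card T * (- p) ^ card I)"
  proof (rule sum.cong)
    fix I assume I: "I \<in> ?Y"
    hence "finite I" "finite T" "T \<inter> I = {}" using V T by (auto intro: finite_subset)
    moreover from this have "T \<union> I - T = I" by auto
    ultimately show "?c (T \<union> I) = p ^ card T * (- p) ^ card I"
      by (simp add: card_Un_disjoint power_add power_minus[of p])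
  qed simp
  finally show ?thesis using True by (simp add: indep_sum_def sum_distrib_left)
next
  case False
  hence "\<not> indep_in G U" if "T \<subseteq> U" for U using that by (auto simp: indep_in_def)
  thus ?thesis using False by (auto simp: shearer_weight_def intro!: sum.neutral)
qed

lemma shearer_weight_empty: "finite V \<Longrightarrow> shearer_weight G p V {} = indep_sum G p V"
  by (simp add: shearer_weight_eq indep_in_def)

text \<open>Complements in \<open>U\<close> turn this into the alternating sum over all subsets of
  \<open>U - S\<close>, the expansion of a product of factors \<open>1 - 1\<close>.\<close>

lemma sum_interval_minus_one:
  assumes "finite U" "S \<subseteq> U"
  shows "(\<Sum>T | S \<subseteq> T \<and> T \<subseteq> U. (-1) ^ card (U - T)) = (if S = U then 1 else 0 :: real)"
proof -
  let ?D = "U - S"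
  have "(\<Sum>T | S \<subseteq> T \<and> T \<subseteq> U. (-1) ^ card (U - T) :: real) = (\<Sum>R\<in>Pow ?D. (-1) ^ card R)"
    by (rule sum.reindex_bij_witness[of _ "\<lambda>R. U - R" "\<lambda>T. U - T"]) (use assms in \<open>auto simp: double_diff\<close>)
  also have "\<dots> = (\<Prod>x\<in>?D. 1 - 1)"
    using prod_diff_conv_sum[of ?D "\<lambda>_. 1 :: real" "\<lambda>_. 1"] assms by simp
  also have "\<dots> = (if S = U then 1 else 0)"
    using assms by (auto simp: prod_zero_iff)
  finally show ?thesis .
qed

text \<open>Inverts the definition of the weights: after exchanging the sums, the alternating sum
  over the interval from \<open>S\<close> to \<open>U\<close> vanishes unless \<open>U = S\<close>.
  For \<open>S = {}\<close> the weights add up to 1.\<close>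

lemma sum_shearer_weight:
  assumes V: "finite V" and S: "S \<subseteq> V"
  shows "(\<Sum>T | S \<subseteq> T \<and> T \<subseteq> V. shearer_weight G p V T) = (if indep_in G S then p ^ card S else 0)"
proof -
  let ?c = "\<lambda>U. if indep_in G U then p ^ card U else 0"
  have fin: "finite {T. S \<subseteq> T \<and> T \<subseteq> V}" "finite {U. U \<subseteq> V \<and> P U}" for P
    using V by (auto intro: finite_subset[of _ "Pow V"])
  have "(\<Sum>T | S \<subseteq> T \<and> T \<subseteq> V. shearer_weight G p V T) =
      (\<Sum>T\<in>{T. S \<subseteq> T \<and> T \<subseteq> V}. \<Sum>U | U \<in> {U. S \<subseteq> U \<and> U \<subseteq> V} \<and> T \<subseteq> U. (-1) ^ card (U - T) * ?c U)"
    unfolding shearer_weight_def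
    by (intro sum.cong) auto
  also have "\<dots> = (\<Sum>U\<in>{U. S \<subseteq> U \<and> U \<subseteq> V}. \<Sum>T | T \<in> {T. S \<subseteq> T \<and> T \<subseteq> V} \<and> T \<subseteq> U. (-1) ^ card (U - T) * ?c U)"
    by (rule sum.swap_restrict) (use fin in auto)
  also have "\<dots> = (\<Sum>U\<in>{U. S \<subseteq> U \<and> U \<subseteq> V}. if U = S then ?c U else 0)"
  proof (rule sum.cong)
    fix U assume U: "U \<in> {U. S \<subseteq> U \<and> U \<subseteq> V}"
    hence "{T. T \<in> {T. S \<subseteq> T \<and> T \<subseteq> V} \<and> T \<subseteq> U} = {T. S \<subseteq> T \<and> T \<subseteq> U}" by auto
    hence "(\<Sum>T | T \<in> {T. S \<subseteq> T \<and> T \<subseteq> V} \<and> T \<subseteq> U. (-1) ^ card (U - T) * ?c U) =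
        (\<Sum>T | S \<subseteq> T \<and> T \<subseteq> U. (-1) ^ card (U - T)) * ?c U"
      by (simp add: sum_distrib_right)
    also have "\<dots> = (if U = S then ?c U else 0)"
      using sum_interval_minus_one[of U S] U finite_subset[OF _ V, of U] by simp
    finally show "(\<Sum>T | T \<in> {T. S \<subseteq> T \<and> T \<subseteq> V} \<and> T \<subseteq> U. (-1) ^ card (U - T) * ?c U) =
        (if U = S then ?c U else 0)" .
  qed simp
  also have "\<dots> = ?c S" using S fin by (simp add: sum.delta)
  finally show ?thesis .
qed

text \<open>An outcome is the set of the events that occur. \<open>sum_shearer_weight\<close> yields
  the total mass and the probability of every joint occurrence \<open>C S\<close>; independence is
  checked on these sets.\<close>

lemma shearer_space:
  assumes V: "finite V" and w: "\<And>T. T \<subseteq> V \<Longrightarrow> shearer_weight G p V T \<ge> 0"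
    and loops: "\<And>v. {v} \<notin> G"
  defines "M \<equiv> point_measure (Pow V) (\<lambda>T. ennreal (shearer_weight G p V T))"
    and "A \<equiv> \<lambda>i. {T \<in> Pow V. i \<in> T}"
  shows "prob_space M"
    and "i \<in> V \<Longrightarrow> measure M (A i) = p"
    and "i \<in> V \<Longrightarrow> prob_space.indep_set M {A i} (sigma_sets (space M) (A ` {j \<in> V. j \<noteq> i \<and> {i, j} \<notin> G}))"
    and "measure M (space M - (\<Union>i\<in>V. A i)) = shearer_weight G p V {}"
proof -
  have sp [simp]: "space M = Pow V" "sets M = Pow (Pow V)"
    by (auto simp: M_def space_point_measure sets_point_measure)
  have meas: "measure M X = (\<Sum>T\<in>X. shearer_weight G p V T)" if "X \<subseteq> Pow V" for X
    unfolding M_def measure_def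
    by (subst emeasure_point_measure_finite)
       (use V w that in \<open>auto simp: sum_ennreal subset_eq intro!: enn2real_ennreal sum_nonneg\<close>)
  define C where "C S = {T \<in> Pow V. S \<subseteq> T}" for S
  have measC: "measure M (C S) = (if indep_in G S then p ^ card S else 0)" if "S \<subseteq> V" for S
  proof -
    have "C S = {T. S \<subseteq> T \<and> T \<subseteq> V}" by (auto simp: C_def)
    thus ?thesis using sum_shearer_weight[OF V that, of G p] by (subst meas) auto
  qed
  have "emeasure M (space M) = ennreal (measure M (C {}))"
  proof -
    have "emeasure M (space M) = (\<Sum>T\<in>Pow V. ennreal (shearer_weight G p V T))"
      unfolding sp by (simp add: M_def emeasure_point_measure_finite V)
    also have "\<dots> = ennreal (\<Sum>T\<in>Pow V. shearer_weight G p V T)"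
      using w by (intro sum_ennreal) auto
    finally show ?thesis by (subst meas) (auto simp: C_def Pow_def)
  qed
  also have "measure M (C {}) = 1" by (subst measC) (auto simp: indep_in_def)
  finally show "prob_space M" by (intro prob_spaceI) simp
  then interpret prob_space M .
  have AC: "A i = C {i}" for i by (auto simp: A_def C_def)
  show mA: "measure M (A i) = p" if "i \<in> V" for i
    using that loops by (simp add: AC measC indep_in_def)
  show "measure M (space M - (\<Union>i\<in>V. A i)) = shearer_weight G p V {}"
  proof -
    have "space M - (\<Union>i\<in>V. A i) = {{}}" by (auto simp: A_def)
    thus ?thesis by (simp add: meas)
  qed
  show "indep_set {A i} (sigma_sets (space M) (A ` {j \<in> V. j \<noteq> i \<and> {i, j} \<notin> G}))" if i: "i \<in> V" for i
  proof -
    define J where "J = {j \<in> V. j \<noteq> i \<and> {i, j} \<notin> G}"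
    have "indep_set {A i} (C ` Pow J)"
      unfolding indep_sets2_eq
    proof (intro conjI ballI)
      fix a b assume "a \<in> {A i}" "b \<in> C ` Pow J"
      then obtain K where K: "K \<subseteq> J" "b = C K" "a = A i" by auto
      have KV: "K \<subseteq> V" "i \<notin> K" "finite K" using K V by (auto simp: J_def intro: finite_subset)
      have "a \<inter> b = C (insert i K)" using K by (auto simp: A_def C_def)
      moreover have "indep_in G (insert i K) \<longleftrightarrow> indep_in G K"
        using indep_in_Un[of G "{i}" K] loops K by (auto simp: indep_in_def J_def)
      ultimately show "prob (a \<inter> b) = prob a * prob b"
        using K KV i mA[OF i] by (simp add: measC)
    qed (auto simp: A_def C_def)
    \<comment> \<open>Joint occurrences are closed under intersection and include the single events,
      so independence extends to the generated \<sigma>-algebra.\<close>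
    moreover have "Int_stable (C ` Pow J)"
    proof (rule Int_stableI)
      fix a b assume "a \<in> C ` Pow J" "b \<in> C ` Pow J"
      then obtain K L where "K \<subseteq> J" "L \<subseteq> J" "a = C K" "b = C L" by auto
      moreover have "C K \<inter> C L = C (K \<union> L)" by (auto simp: C_def)
      ultimately show "a \<inter> b \<in> C ` Pow J" by auto
    qed
    ultimately have "indep_set (sigma_sets (space M) {A i}) (sigma_sets (space M) (C ` Pow J))"
      by (intro indep_set_sigma_sets) (auto simp: Int_stable_def)
    moreover have "sigma_sets (space M) (A ` J) \<subseteq> sigma_sets (space M) (C ` Pow J)"
      by (rule sigma_sets_mono') (auto simp: AC)
    ultimately show ?thesis
      unfolding indep_sets2_eq J_def[symmetric] by (blast intro: sigma_sets.Basic)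
  qed
qed

section \<open>Independence polynomials of paths at the Shearer point\<close>

context
  fixes n :: nat and p :: real and f :: "nat \<Rightarrow> real" and N :: nat
    and G :: "'a set set" and \<tau> :: "nat \<Rightarrow> 'a"
  assumes sp: "shearer_point n p f" and N: "N < n" and inj: "inj_on \<tau> {..<N}"
    and path: "\<And>a b. a < N \<Longrightarrow> b < N \<Longrightarrow> {\<tau> a, \<tau> b} \<in> G \<longleftrightarrow> b = a + 1 \<or> a = b + 1"
begin

lemma path_notin: "k < N \<Longrightarrow> \<tau> k \<notin> \<tau> ` {..<k}"
  using inj by (force simp: inj_on_def)

lemma path_no_loop: "k < N \<Longrightarrow> {\<tau> k} \<notin> G"
  using path[of k k] by simp

text \<open>Deleting the last vertex of the path gives the recursion that defines
  \<open>f\<close>.\<close>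

lemma indep_sum_path: "k \<le> N \<Longrightarrow> indep_sum G p (\<tau> ` {..<k}) = f k"
proof (induction k rule: less_induct)
  case (less k)
  show ?case
  proof (cases k)
    case 0
    thus ?thesis using sp by (simp add: shearer_point_def)
  next
    case (Suc j)
    hence j: "j < N" using less.prems by simp
    let ?N = "{w \<in> \<tau> ` {..<j}. {\<tau> j, w} \<notin> G}"
    have N: "?N = \<tau> ` {..<j - 1}"
    proof -
      have "{a. a < j \<and> {\<tau> j, \<tau> a} \<notin> G} = {..<j - 1}" using path[of j] j by auto
      moreover have "?N = \<tau> ` {a. a < j \<and> {\<tau> j, \<tau> a} \<notin> G}" by auto
      ultimately show ?thesis by simp
    qed
    have "\<tau> ` {..<k} = insert (\<tau> j) (\<tau> ` {..<j})" by (simp add: Suc lessThan_Suc)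
    hence "indep_sum G p (\<tau> ` {..<k}) = indep_sum G p (\<tau> ` {..<j}) - p * indep_sum G p ?N"
      using j path_notin path_no_loop by (simp add: indep_sum_insert)
    also have "\<dots> = f j - p * f (j - 1)"
      using less.IH[of j] less.IH[of "j - 1"] j by (simp add: N Suc)
    \<comment> \<open>For \<open>j = 0\<close> the truncated \<open>j - 1\<close> is 0, and
      \<open>f 0 - p * f 0 = 1 - p = f 1\<close>.\<close>
    also have "\<dots> = f k"
      using sp by (cases j) (auto simp: Suc shearer_point_def)
    finally show ?thesis .
  qed
qed

lemma shearer_point_decreasing: "k < n \<Longrightarrow> f (k + 1) \<le> f k"
proof (cases k)
  case (Suc j)
  moreover assume "k < n"
  ultimately have "f j > 0" "f (j + 2) = f (j + 1) - p * f j" "p > 0"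
    using sp by (auto simp: shearer_point_def)
  thus ?thesis using Suc by simp
qed (use sp in \<open>simp add: shearer_point_def\<close>)

text \<open>The ratio bound drives the induction for positivity: adding the next vertex to a subset
  of the path scales the polynomial by at least \<open>f (k + 1) / f k\<close>, the factor for the
  full path.\<close>

lemma indep_sum_path_ratio:
  assumes "k \<le> N" "W \<subseteq> \<tau> ` {..<k}"
  shows "indep_sum G p W > 0 \<and>
    (k < N \<longrightarrow> f (k + 1) * indep_sum G p W \<le> f k * indep_sum G p (insert (\<tau> k) W))"
  using assms
proof (induction k arbitrary: W)
  case 0
  hence W: "W = {}" by simp
  have "f 1 \<le> f 0 * indep_sum G p {\<tau> 0}" if "0 < N"
    using indep_sum_path[of 1] that sp by (simp add: shearer_point_def lessThan_Suc)
  thus ?case by (simp add: W)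
next
  case (Suc j)
  let ?q = "indep_sum G p"
  have j: "j < N" "\<tau> j \<notin> W - {\<tau> j}" and f: "f j > 0" "f (j + 1) > 0"
    and rec: "f (j + 2) = f (j + 1) - p * f j" and p: "p > 0"
    using Suc.prems N sp by (auto simp: shearer_point_def)
  have W: "W - {\<tau> j} \<subseteq> \<tau> ` {..<j}" using Suc.prems by (auto simp: lessThan_Suc)
  have fW: "finite W" using Suc.prems finite_surj by auto
  note IH = Suc.IH[OF less_imp_le[OF j(1)] W]
  \<comment> \<open>The only earlier vertex of the path adjacent to \<open>\<tau> (j + 1)\<close> is
    \<open>\<tau> j\<close>.\<close>
  have ins: "?q (insert (\<tau> (j + 1)) W) = ?q W - p * ?q (W - {\<tau> j})" if "j + 1 < N"
  proof -
    have "{\<tau> (j + 1), w} \<notin> G \<longleftrightarrow> w \<noteq> \<tau> j" if w: "w \<in> W" for w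
    proof -
      obtain a where "a < j + 1" "w = \<tau> a" using w Suc.prems by auto
      thus ?thesis using path[of "j + 1" a] inj \<open>j + 1 < N\<close> by (auto simp: inj_on_def)
    qed
    hence "{w \<in> W. {\<tau> (j + 1), w} \<notin> G} = W - {\<tau> j}" by auto
    moreover have "\<tau> (j + 1) \<notin> W" using path_notin[OF that] Suc.prems by auto
    ultimately show ?thesis using fW path_no_loop[OF that] by (simp add: indep_sum_insert)
  qed
  show ?case
  proof (cases "\<tau> j \<in> W")
    case True
    hence ineq: "f (j + 1) * ?q (W - {\<tau> j}) \<le> f j * ?q W" using IH j by (simp add: insert_absorb)
    have "0 < f (j + 1) * ?q (W - {\<tau> j})" using IH f by simp
    also note ineq
    finally have "?q W > 0" using f by (simp add: zero_less_mult_iff)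
    moreover have "f (j + 2) * ?q W \<le> f (j + 1) * ?q (insert (\<tau> (j + 1)) W)" if "j + 1 < N"
      using mult_left_mono[OF ineq, of p] p unfolding ins[OF that] rec by (simp add: algebra_simps)
    ultimately show ?thesis by simp
  next
    case False
    \<comment> \<open>Without \<open>\<tau> j\<close> the new vertex is isolated and contributes the
      factor \<open>1 - p\<close>, so monotonicity of \<open>f\<close> suffices.\<close>
    hence eq: "W - {\<tau> j} = W" by simp
    moreover have "f (j + 2) * ?q W \<le> f (j + 1) * ?q (insert (\<tau> (j + 1)) W)" if "j + 1 < N"
    proof -
      have "f (j + 1) * (p * ?q W) \<le> f j * (p * ?q W)"
        using shearer_point_decreasing[of j] j N IH p eq by (intro mult_right_mono) auto
      thus ?thesis unfolding ins[OF that] rec eq by (simp add: algebra_simps)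
    qed
    ultimately show ?thesis using IH by simp
  qed
qed

end

section \<open>Shearer's weights on the cycle\<close>

lemma cycle_order_path:
  assumes "cycle_order n G \<sigma>"
  shows "inj_on \<sigma> {..<n - 1}"
    and "a < n - 1 \<Longrightarrow> b < n - 1 \<Longrightarrow> {\<sigma> a, \<sigma> b} \<in> G \<longleftrightarrow> b = a + 1 \<or> a = b + 1"
proof -
  show "inj_on \<sigma> {..<n - 1}" using cycle_order_inj[OF assms] by (auto simp: inj_on_def)
  show "{\<sigma> a, \<sigma> b} \<in> G \<longleftrightarrow> b = a + 1 \<or> a = b + 1" if "a < n - 1" "b < n - 1"
    using cycle_order_edge_iff[OF assms, of a b] that by auto
qed

lemma cycle_order_image:
  assumes "cycle_order n G \<sigma>"
  shows "{1..n} = insert (\<sigma> (n - 1)) (\<sigma> ` {..<n - 1})"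
proof -
  have n: "n = Suc (n - 1)" using assms by (auto simp: cycle_order_def)
  have "{1..n} = \<sigma> ` {..<n}" using assms by (auto simp: cycle_order_def bij_betw_def)
  also have "\<dots> = insert (\<sigma> (n - 1)) (\<sigma> ` {..<n - 1})" by (subst n) (simp add: lessThan_Suc)
  finally show ?thesis .
qed

text \<open>Deleting the last vertex leaves a path on \<open>n - 1\<close> vertices, and its
  non-neighbours form a path on \<open>n - 3\<close> vertices, so the polynomial is
  \<open>f (n - 1) - p * f (n - 3)\<close>.\<close>

lemma indep_sum_cycle:
  assumes c: "cycle_order n G \<sigma>" and sp: "shearer_point n p f"
  shows "indep_sum G p {1..n} = 0"
proof -
  have n: "n \<ge> 3" using c by (simp add: cycle_order_def)
  \<comment> \<open>Rotated by one, so that the path of non-neighbours of the last vertex, at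
    positions 1 to \<open>n - 3\<close>, starts at index 0.\<close>
  let ?\<tau> = "\<lambda>k. \<sigma> ((k + 1) mod n)"
  let ?W = "\<sigma> ` {..<n - 1}"
  have "{w \<in> ?W. {\<sigma> (n - 1), w} \<notin> G} = ?\<tau> ` {..<n - 3}"
  proof -
    have iff: "{\<sigma> (n - 1), \<sigma> a} \<in> G \<longleftrightarrow> a = 0 \<or> a = n - 2" if "a < n - 1" for a
      using cycle_order_edge_less_iff[OF c that] that n by (auto simp: insert_commute)
    have "{w \<in> ?W. {\<sigma> (n - 1), w} \<notin> G} = \<sigma> ` {1..n-3}"
    proof -
      have "{w \<in> ?W. {\<sigma> (n - 1), w} \<notin> G} = \<sigma> ` {a. a < n - 1 \<and> {\<sigma> (n - 1), \<sigma> a} \<notin> G}" by auto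
      also have "{a. a < n - 1 \<and> {\<sigma> (n - 1), \<sigma> a} \<notin> G} = {a. a < n - 1 \<and> \<not> (a = 0 \<or> a = n - 2)}"
        using iff by blast
      also have "\<dots> = {1..n-3}" using n by auto
      finally show ?thesis .
    qed
    also have "{1..n-3} = Suc ` {..<n-3}" by (simp add: image_Suc_lessThan)
    also have "\<sigma> ` \<dots> = ?\<tau> ` {..<n - 3}" unfolding image_image by (rule image_cong) auto
    finally show ?thesis .
  qed
  moreover have "indep_sum G p (?\<tau> ` {..<n - 3}) = f (n - 3)"
    using n cycle_order_path[OF cycle_order_rotate[OF c, of 1]]
    by (intro indep_sum_path[OF sp, of "n - 1"]) auto
  moreover have "indep_sum G p ?W = f (n - 1)"
    using n cycle_order_path[OF c] by (intro indep_sum_path[OF sp, of "n - 1"]) auto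
  moreover have "\<sigma> (n - 1) \<notin> ?W" "{\<sigma> (n - 1)} \<notin> G"
    using cycle_order_inj[OF c] cycle_order_edge_iff[OF c, of "n - 1" "n - 1"] n by auto
  ultimately have "indep_sum G p {1..n} = f (n - 1) - p * f (n - 3)"
    unfolding cycle_order_image[OF c] by (simp add: indep_sum_insert)
  thus ?thesis using sp by (simp add: shearer_point_def)
qed

text \<open>The weight of the empty set is the polynomial of the cycle, which vanishes. A nonempty
  \<open>T\<close> contains a vertex whose removal turns the cycle into a path, and all subsets of
  that path have positive polynomial.\<close>

lemma shearer_weight_cycle_nonneg:
  assumes c: "cycle_order n G \<sigma>" and sp: "shearer_point n p f" and T: "T \<subseteq> {1..n}"
  shows "shearer_weight G p {1..n} T \<ge> 0"
proof (cases "T = {}")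
  case True
  thus ?thesis using indep_sum_cycle[OF c sp] by (simp add: shearer_weight_empty)
next
  case False
  have n: "n \<ge> 3" and b: "\<sigma> ` {..<n} = {1..n}" using c by (auto simp: cycle_order_def bij_betw_def)
  obtain t where t: "t \<in> T" using False by auto
  then obtain i where i: "i < n" "t = \<sigma> i" using T b by blast
  \<comment> \<open>Starting just after \<open>t\<close> puts \<open>t\<close> at the last position
    \<open>n - 1\<close>.\<close>
  let ?\<tau> = "\<lambda>k. \<sigma> ((k + (i + 1)) mod n)"
  have c': "cycle_order n G ?\<tau>" by (rule cycle_order_rotate[OF c])
  have "n - 1 + (i + 1) = n + i" using n by simp
  hence "?\<tau> (n - 1) = t" using i by simp
  hence "{1..n} = insert t (?\<tau> ` {..<n - 1})" using cycle_order_image[OF c'] by simp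
  hence "{v \<in> {1..n} - T. \<forall>t\<in>T. {t, v} \<notin> G} \<subseteq> ?\<tau> ` {..<n - 1}" using t by auto
  hence "indep_sum G p {v \<in> {1..n} - T. \<forall>t\<in>T. {t, v} \<notin> G} > 0"
    using n cycle_order_path[OF c']
      indep_sum_path_ratio[OF sp, of "n - 1" ?\<tau> G "n - 1"] by auto
  moreover have "p > 0" using sp by (simp add: shearer_point_def)
  ultimately show ?thesis using T by (simp add: shearer_weight_eq)
qed

text \<open>The outcome of Shearer's space in which no event occurs is the empty set, and its weight
  is the independence polynomial of the cycle, hence 0.\<close>

lemma shearer_point_notin_abstract_interior:
  assumes c: "cycle_order n G \<sigma>" and sp: "shearer_point n p f"
  shows "(\<lambda>i. p) \<notin> abstract_interior n G"
proof
  assume int: "(\<lambda>i. p) \<in> abstract_interior n G"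
  have loops: "{v} \<notin> G" for v
  proof
    assume "{v} \<in> G"
    then obtain k where "k < n" "{v} = {\<sigma> k, \<sigma> ((k + 1) mod n)}" using c by (auto simp: cycle_order_def)
    hence "\<sigma> k = \<sigma> ((k + 1) mod n)" by (metis insertI1 insertI2 singletonD)
    hence "(k + 1) mod n = k" using cycle_order_inj[OF c] \<open>k < n\<close> by auto
    moreover have "n \<ge> 3" using c by (simp add: cycle_order_def)
    ultimately show False using \<open>k < n\<close> by (cases "k + 1 = n") auto
  qed
  note S = shearer_space[OF finite_atLeastAtMost shearer_weight_cycle_nonneg[OF c sp] loops]
  let ?w = "shearer_weight G p {1..n}"
  let ?M = "point_measure (Pow {1..n}) (\<lambda>T. ennreal (?w T))"
  let ?A = "\<lambda>i. {T \<in> Pow {1..n}. i \<in> T}"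
  have lll: "abstract_lll ?M n G (\<lambda>i. p)" by (rule abstract_interior_any_space[OF int S(1)])
  have dep: "dependency_graph ?M n G ?A"
    unfolding dependency_graph_def using S(3) by blast
  have A: "\<forall>i\<in>{1..n}. ?A i \<in> sets ?M \<and> measure ?M (?A i) = p"
    using S(2) by (auto simp: sets_point_measure)
  have "measure ?M (space ?M - (\<Union>i\<in>{1..n}. ?A i)) > 0"
    by (rule lll[unfolded abstract_lll_def, THEN spec, THEN mp, OF conjI[OF A dep]])
  hence "?w {} > 0" using S(4) by simp
  thus False using indep_sum_cycle[OF c sp] by (simp add: shearer_weight_empty)
qed

section \<open>Events determined by a set of coordinates\<close>

context finite_product_prob_space begin

text \<open>Stated as invariance under changes outside \<open>J\<close> rather than as a cylinder
  over a base, so that closure under Boolean operations is immediate.\<close>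

definition determined :: "'a set \<Rightarrow> ('a \<Rightarrow> 'b) set \<Rightarrow> bool" where
  "determined J A \<longleftrightarrow> A \<in> sets (Pi\<^sub>M I M) \<and>
    (\<forall>x\<in>space (Pi\<^sub>M I M). \<forall>y\<in>space (Pi\<^sub>M I M). (\<forall>j\<in>J. x j = y j) \<longrightarrow> x \<in> A \<longrightarrow> y \<in> A)"

lemma determined_sets: "determined J A \<Longrightarrow> A \<in> sets (Pi\<^sub>M I M)"
  by (simp add: determined_def)

lemma determined_mono: "determined J A \<Longrightarrow> J \<subseteq> K \<Longrightarrow> determined K A"
  unfolding determined_def by blast

lemma determined_space: "determined J (space (Pi\<^sub>M I M))"
  by (simp add: determined_def)

lemma determined_Int: "determined J A \<Longrightarrow> determined K B \<Longrightarrow> determined (J \<union> K) (A \<inter> B)"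
  unfolding determined_def by blast

lemma determined_Diff_UN:
  assumes "finite T" "\<And>k. k \<in> T \<Longrightarrow> determined (J k) (A k)"
  shows "determined (\<Union>k\<in>T. J k) (space (Pi\<^sub>M I M) - (\<Union>k\<in>T. A k))"
  unfolding determined_def
proof (intro conjI ballI impI)
  show "space (Pi\<^sub>M I M) - (\<Union>k\<in>T. A k) \<in> sets (Pi\<^sub>M I M)"
    using assms by (intro sets.Diff sets.top sets.finite_UN) (auto simp: determined_def)
next
  fix x y assume xy: "x \<in> space (Pi\<^sub>M I M)" "y \<in> space (Pi\<^sub>M I M)" "\<forall>j\<in>(\<Union>k\<in>T. J k). x j = y j"
    "x \<in> space (Pi\<^sub>M I M) - (\<Union>k\<in>T. A k)"
  have "y \<notin> A k" if k: "k \<in> T" for k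
  proof
    assume "y \<in> A k"
    moreover have "\<forall>j\<in>J k. y j = x j" using xy(3) k by auto
    ultimately have "x \<in> A k" using assms(2)[OF k] xy(1,2) unfolding determined_def by blast
    thus False using xy(4) k by blast
  qed
  thus "y \<in> space (Pi\<^sub>M I M) - (\<Union>k\<in>T. A k)" using xy(2) by blast
qed

text \<open>The conditional probability of \<open>B\<close> given the coordinates in
  \<open>J\<close>, as the measure of a section. \<open>merge\<close> reads \<open>x\<close> only on
  \<open>J\<close>, so \<open>x\<close> may be a point of either product.\<close>

definition section_weight :: "'a set \<Rightarrow> ('a \<Rightarrow> 'b) set \<Rightarrow> ('a \<Rightarrow> 'b) \<Rightarrow> ennreal" where
  "section_weight J B x = (\<integral>\<^sup>+ y. indicator B (merge J (I - J) (x, y)) \<partial>Pi\<^sub>M (I - J) M)"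

lemma merge_space:
  assumes "J \<subseteq> I" "x \<in> space (Pi\<^sub>M J M) \<or> x \<in> space (Pi\<^sub>M I M)" "y \<in> space (Pi\<^sub>M (I - J) M)"
  shows "merge J (I - J) (x, y) \<in> space (Pi\<^sub>M I M)"
  using assms by (auto simp: space_PiM PiE_iff merge_def extensional_def)

text \<open>\<open>B\<close> sees only the coordinates in \<open>K\<close>, and those outside
  \<open>J\<close> are integrated out, so \<open>x\<close> matters only on
  \<open>J \<inter> K\<close>.\<close>

lemma section_weight_cong:
  assumes "J \<subseteq> I" "determined K B"
    and "x \<in> space (Pi\<^sub>M J M) \<or> x \<in> space (Pi\<^sub>M I M)" "x' \<in> space (Pi\<^sub>M J M) \<or> x' \<in> space (Pi\<^sub>M I M)"
    and "\<And>j. j \<in> J \<inter> K \<Longrightarrow> x j = x' j" and "K \<subseteq> I"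
  shows "section_weight J B x = section_weight J B x'"
  unfolding section_weight_def
proof (rule nn_integral_cong)
  fix y assume y: "y \<in> space (Pi\<^sub>M (I - J) M)"
  let ?m = "\<lambda>x. merge J (I - J) (x, y)"
  have "?m x j = ?m x' j" if "j \<in> K" for j
    using assms(5,6) that by (cases "j \<in> J") auto
  moreover have "?m x \<in> space (Pi\<^sub>M I M)" "?m x' \<in> space (Pi\<^sub>M I M)"
    using merge_space assms y by blast+
  ultimately have "?m x \<in> B \<longleftrightarrow> ?m x' \<in> B" using assms(2) unfolding determined_def by metis
  thus "indicator B (?m x) = (indicator B (?m x') :: ennreal)" by (simp add: indicator_def)
qed

lemma measurable_section_weight:
  assumes "J \<subseteq> I" "B \<in> sets (Pi\<^sub>M I M)"
  shows "section_weight J B \<in> borel_measurable (Pi\<^sub>M I M)"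
proof -
  interpret K: finite_product_prob_space M "I - J" by standard (use finite_index in auto)
  have I: "J \<union> (I - J) = I" using assms by auto
  note [measurable] = assms(2)
  have [measurable]: "(\<lambda>x. restrict x J) \<in> measurable (Pi\<^sub>M I M) (Pi\<^sub>M J M)"
    by (rule measurable_restrict_subset[OF assms(1)])
  have [measurable]: "merge J (I - J) \<in> measurable (Pi\<^sub>M J M \<Otimes>\<^sub>M Pi\<^sub>M (I - J) M) (Pi\<^sub>M I M)"
    using measurable_merge[of J "I - J" M] unfolding I .
  \<comment> \<open>Restricting \<open>x\<close> to \<open>J\<close> does not change the merged
    point and makes the integrand a composition of measurable maps.\<close>
  have "(\<lambda>x. \<integral>\<^sup>+ y. indicator B (merge J (I - J) (restrict x J, y)) \<partial>Pi\<^sub>M (I - J) M)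
      \<in> borel_measurable (Pi\<^sub>M I M)" by measurable
  thus ?thesis by (simp add: section_weight_def[abs_def])
qed

text \<open>Fubini over the coordinates in \<open>J\<close> and the remaining ones: \<open>A\<close>
  contains each section with fixed \<open>J\<close> coordinates entirely or not at all, so
  \<open>B\<close> may be replaced there by its conditional probability.\<close>

lemma emeasure_Int_determined:
  assumes J: "J \<subseteq> I" and A: "determined J A" and B: "B \<in> sets (Pi\<^sub>M I M)"
  shows "emeasure (Pi\<^sub>M I M) (A \<inter> B) = (\<integral>\<^sup>+ x. indicator A x * section_weight J B x \<partial>Pi\<^sub>M I M)"
proof -
  interpret K: finite_product_prob_space M "I - J" by standard (use finite_index in auto)
  have I: "J \<union> (I - J) = I" using J by auto
  have fJ: "finite J" "finite (I - J)" using J finite_index finite_subset by auto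
  note [measurable] = determined_sets[OF A] B measurable_section_weight[OF J B]
  have fold: "integral\<^sup>N (Pi\<^sub>M I M) g =
      (\<integral>\<^sup>+ x. \<integral>\<^sup>+ y. g (merge J (I - J) (x, y)) \<partial>Pi\<^sub>M (I - J) M \<partial>Pi\<^sub>M J M)"
    if "g \<in> borel_measurable (Pi\<^sub>M I M)" for g
    using product_nn_integral_fold[of J "I - J" g] that fJ unfolding I by simp
  have "emeasure (Pi\<^sub>M I M) (A \<inter> B) = (\<integral>\<^sup>+ x. indicator A x * indicator B x \<partial>Pi\<^sub>M I M)"
    by (simp add: indicator_inter_arith[symmetric])
  also have "\<dots> = (\<integral>\<^sup>+ x. indicator A x * section_weight J B x \<partial>Pi\<^sub>M I M)"
  proof (subst (1 2) fold)
    show "(\<integral>\<^sup>+ x. \<integral>\<^sup>+ y. indicator A (merge J (I - J) (x, y)) * indicator B (merge J (I - J) (x, y))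
        \<partial>Pi\<^sub>M (I - J) M \<partial>Pi\<^sub>M J M) =
      (\<integral>\<^sup>+ x. \<integral>\<^sup>+ y. indicator A (merge J (I - J) (x, y)) * section_weight J B (merge J (I - J) (x, y))
        \<partial>Pi\<^sub>M (I - J) M \<partial>Pi\<^sub>M J M)"
    proof (rule nn_integral_cong)
      fix x assume x: "x \<in> space (Pi\<^sub>M J M)"
      let ?m = "\<lambda>y. merge J (I - J) (x, y)" and ?S = "space (Pi\<^sub>M (I - J) M)"
      have m: "?m y \<in> space (Pi\<^sub>M I M)" if "y \<in> ?S" for y using merge_space[OF J] x that by blast
      have sw: "section_weight J B (?m y) = section_weight J B x" if "y \<in> ?S" for y
        unfolding section_weight_def by (intro nn_integral_cong) (simp add: merge_def cong: if_cong)
      have "(\<forall>y\<in>?S. ?m y \<in> A) \<or> (\<forall>y\<in>?S. ?m y \<notin> A)"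
      proof (rule disjCI)
        assume "\<not> (\<forall>y\<in>?S. ?m y \<notin> A)"
        then obtain z where z: "z \<in> ?S" "?m z \<in> A" by auto
        have "?m y \<in> A" if "y \<in> ?S" for y
        proof -
          have "\<forall>j\<in>J. ?m z j = ?m y j" by simp
          thus ?thesis using A z m that unfolding determined_def by blast
        qed
        thus "\<forall>y\<in>?S. ?m y \<in> A" by blast
      qed
      thus "(\<integral>\<^sup>+ y. indicator A (?m y) * indicator B (?m y) \<partial>Pi\<^sub>M (I - J) M) =
        (\<integral>\<^sup>+ y. indicator A (?m y) * section_weight J B (?m y) \<partial>Pi\<^sub>M (I - J) M)"
      proof
        assume *: "\<forall>y\<in>?S. ?m y \<in> A"
        have "(\<integral>\<^sup>+ y. indicator A (?m y) * indicator B (?m y) \<partial>Pi\<^sub>M (I - J) M) = section_weight J B x"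
          unfolding section_weight_def by (intro nn_integral_cong) (simp add: *)
        also have "\<dots> = (\<integral>\<^sup>+ y. section_weight J B x \<partial>Pi\<^sub>M (I - J) M)"
          by (simp add: K.emeasure_space_1)
        also have "\<dots> = (\<integral>\<^sup>+ y. indicator A (?m y) * section_weight J B (?m y) \<partial>Pi\<^sub>M (I - J) M)"
          by (intro nn_integral_cong) (simp add: * sw)
        finally show ?thesis .
      next
        assume *: "\<forall>y\<in>?S. ?m y \<notin> A"
        show ?thesis by (intro nn_integral_cong) (simp add: *)
      qed
    qed
  qed auto
  finally show ?thesis .
qed

text \<open>For disjoint \<open>J\<close> and \<open>K\<close> the conditional probability of
  \<open>B\<close> given the coordinates in \<open>J\<close> is constant; taking the whole space for
  \<open>A'\<close> identifies the constant as the probability of \<open>B\<close>.\<close>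

lemma determined_indep:
  assumes "J \<subseteq> I" "K \<subseteq> I" "J \<inter> K = {}" "determined J A" "determined K B"
  shows "prob (A \<inter> B) = prob A * prob B"
proof -
  have "space (Pi\<^sub>M I M) \<noteq> {}" using not_empty by (simp add: space_PiM PiE_eq_empty_iff)
  then obtain z where z: "z \<in> space (Pi\<^sub>M I M)" by blast
  let ?c = "section_weight J B z"
  have A: "emeasure (Pi\<^sub>M I M) (A' \<inter> B) = emeasure (Pi\<^sub>M I M) A' * ?c" if "determined J A'" for A'
  proof -
    have "emeasure (Pi\<^sub>M I M) (A' \<inter> B) = (\<integral>\<^sup>+ x. indicator A' x * section_weight J B x \<partial>Pi\<^sub>M I M)"
      by (rule emeasure_Int_determined) (use assms that determined_sets in auto)
    also have "\<dots> = (\<integral>\<^sup>+ x. indicator A' x * ?c \<partial>Pi\<^sub>M I M)"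
      using section_weight_cong[OF assms(1,5) _ _ _ assms(2)] z assms(3)
      by (intro nn_integral_cong arg_cong2[where f = times]) auto
    also have "\<dots> = emeasure (Pi\<^sub>M I M) A' * ?c"
      using determined_sets[OF that] by (simp add: nn_integral_multc)
    finally show ?thesis .
  qed
  have "emeasure (Pi\<^sub>M I M) B = ?c"
    using A[OF determined_space] sets.sets_into_space[OF determined_sets[OF assms(5)]]
    by (simp add: Int_absorb1 emeasure_space_1)
  hence "emeasure (Pi\<^sub>M I M) (A \<inter> B) = emeasure (Pi\<^sub>M I M) A * emeasure (Pi\<^sub>M I M) B"
    using A[OF assms(4)] by simp
  thus ?thesis by (simp add: emeasure_eq_measure ennreal_mult'[symmetric])
qed

text \<open>Null-intersecting events are separated by an event in their common coordinates, because
  they are conditionally independent given these.\<close>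

lemma determined_separate:
  assumes "J \<subseteq> I" "K \<subseteq> I" "determined J A" "determined K B" "prob (A \<inter> B) = 0"
  obtains S where "determined (J \<inter> K) S" "prob A \<le> prob S" "prob (S \<inter> B) = 0"
proof
  let ?w = "section_weight J B"
  \<comment> \<open>The points at which \<open>B\<close> has conditional probability 0 given the
    coordinates in \<open>J\<close>; since \<open>B\<close> is determined by \<open>K\<close>, only
    \<open>J \<inter> K\<close> matters.\<close>
  let ?S = "{x \<in> space (Pi\<^sub>M I M). ?w x = 0}"
  have B: "B \<in> sets (Pi\<^sub>M I M)" using assms(4) by (rule determined_sets)
  note [measurable] = measurable_section_weight[OF assms(1) B] determined_sets[OF assms(3)]
  have S_sets: "?S \<in> sets (Pi\<^sub>M I M)" by measurable
  show dS: "determined (J \<inter> K) ?S"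
    unfolding determined_def
  proof (intro conjI ballI impI S_sets)
    fix x y assume xy: "x \<in> space (Pi\<^sub>M I M)" "y \<in> space (Pi\<^sub>M I M)" "\<forall>j\<in>J \<inter> K. x j = y j" "x \<in> ?S"
    have "?w x = ?w y" using section_weight_cong[OF assms(1,4) _ _ _ assms(2)] xy by blast
    thus "y \<in> ?S" using xy by simp
  qed
  have "emeasure (Pi\<^sub>M I M) (?S \<inter> B) = (\<integral>\<^sup>+ x. indicator ?S x * ?w x \<partial>Pi\<^sub>M I M)"
    using dS B by (intro emeasure_Int_determined[OF assms(1)]) (auto intro: determined_mono)
  also have "\<dots> = (\<integral>\<^sup>+ x. 0 \<partial>Pi\<^sub>M I M)" by (intro nn_integral_cong) (simp add: indicator_def)
  finally show "prob (?S \<inter> B) = 0" by (simp add: measure_def)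
  \<comment> \<open>A nonnegative integrand with integral 0 vanishes almost everywhere, so almost
    all of \<open>A\<close> lies in \<open>?S\<close>.\<close>
  have "(\<integral>\<^sup>+ x. indicator A x * ?w x \<partial>Pi\<^sub>M I M) = 0"
    using emeasure_Int_determined[OF assms(1,3) B] assms(5) by (simp add: emeasure_eq_measure)
  hence "AE x in Pi\<^sub>M I M. indicator A x * ?w x = 0" by (subst (asm) nn_integral_0_iff_AE) auto
  hence "AE x in Pi\<^sub>M I M. x \<in> A \<longrightarrow> x \<in> ?S"
    using AE_space by eventually_elim (auto simp: indicator_def)
  thus "prob A \<le> prob ?S" using S_sets by (intro finite_measure_mono_AE) auto
qed

section \<open>Cycles of determined events\<close>

lemma determined_avoid:
  assumes "finite T" "\<And>k. k \<in> T \<Longrightarrow> determined (J k) (A k)"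
  shows "determined (\<Union>k\<in>T. J k) (avoid A T)"
  unfolding avoid_def by (rule determined_Diff_UN[OF assms])

text \<open>Events at nonadjacent positions share no coordinates, so \<open>determined_indep\<close>
  supplies the independence that \<open>cycle_avoid_pos\<close> asks for.\<close>

lemma cycle_determined_avoid_pos:
  assumes J: "\<And>k. k < n \<Longrightarrow> J k \<subseteq> I" and A: "\<And>k. k < n \<Longrightarrow> determined (J k) (A k)"
    and disj: "\<And>a b. a < n \<Longrightarrow> b < n \<Longrightarrow> a \<noteq> b \<Longrightarrow> b \<noteq> (a + 1) mod n \<Longrightarrow> a \<noteq> (b + 1) mod n \<Longrightarrow>
      J a \<inter> J b = {}"
    and p: "\<And>k. k < n \<Longrightarrow> prob (A k) = p" and sp: "shearer_point n p f"
    and pos: "prob (A 0 \<inter> A 1) > 0"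
  shows "prob (avoid A {..<n}) > 0"
proof (rule cycle_avoid_pos[OF _ _ sp pos])
  show "A k \<in> events" if "k < n" for k using A[OF that] by (rule determined_sets)
next
  fix k T assume k: "k < n" "T \<subseteq> {..<n}"
    and T: "\<And>j. j \<in> T \<Longrightarrow> j \<noteq> k \<and> j \<noteq> (k + 1) mod n \<and> k \<noteq> (j + 1) mod n"
  have "finite T" using k(2) finite_subset by auto
  have "prob (A k \<inter> avoid A T) = prob (A k) * prob (avoid A T)"
  proof (rule determined_indep)
    show "J k \<subseteq> I" "(\<Union>j\<in>T. J j) \<subseteq> I" using J k by auto
    show "determined (J k) (A k)" using A k by simp
    show "determined (\<Union>j\<in>T. J j) (avoid A T)" using \<open>finite T\<close> A k by (intro determined_avoid) auto
    have "J k \<inter> J j = {}" if "j \<in> T" for j using T[OF that] that k by (intro disj) auto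
    thus "J k \<inter> (\<Union>j\<in>T. J j) = {}" by blast
  qed
  thus "prob (A k \<inter> avoid A T) = p * prob (avoid A T)" using p k by simp
qed

text \<open>Contraposition of \<open>cycle_determined_avoid_pos\<close>, after a rotation that
  carries the pair \<open>i\<close>, \<open>(i + 1) mod n\<close> to the positions 0 and 1.\<close>

lemma cycle_determined_adjacent_null:
  assumes J: "\<And>k. k < n \<Longrightarrow> J k \<subseteq> I" and A: "\<And>k. k < n \<Longrightarrow> determined (J k) (A k)"
    and disj: "\<And>a b. a < n \<Longrightarrow> b < n \<Longrightarrow> a \<noteq> b \<Longrightarrow> b \<noteq> (a + 1) mod n \<Longrightarrow> a \<noteq> (b + 1) mod n \<Longrightarrow>
      J a \<inter> J b = {}"
    and p: "\<And>k. k < n \<Longrightarrow> prob (A k) = p" and sp: "shearer_point n p f"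
    and null: "prob (avoid A {..<n}) = 0" and i: "i < n"
  shows "prob (A i \<inter> A ((i + 1) mod n)) = 0"
proof (rule ccontr)
  assume nz: "prob (A i \<inter> A ((i + 1) mod n)) \<noteq> 0"
  have n: "n > 1" using sp by (simp add: shearer_point_def)
  let ?r = "\<lambda>k. (k + i) mod n"
  have r: "bij_betw ?r {..<n} {..<n}" using n by (intro bij_betw_rotate_mod) simp
  have inj: "?r a = ?r b \<longleftrightarrow> a = b" if "a < n" "b < n" for a b
    using inj_on_eq_iff[OF bij_betw_imp_inj_on[OF r], of a b] that unfolding lessThan_iff by blast
  have shift: "(?r a + 1) mod n = ?r ((a + 1) mod n)" for a
    by (simp only: mod_add_left_eq mod_add_right_eq ac_simps)
  have "prob (avoid (\<lambda>k. A (?r k)) {..<n}) > 0"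
  proof (rule cycle_determined_avoid_pos[where J = "\<lambda>k. J (?r k)", OF _ _ _ _ sp])
    show "J (?r a) \<inter> J (?r b) = {}"
      if "a < n" "b < n" "a \<noteq> b" "b \<noteq> (a + 1) mod n" "a \<noteq> (b + 1) mod n" for a b
      using that n by (intro disj) (simp_all add: inj shift del: One_nat_def)
    show "prob (A (?r 0) \<inter> A (?r 1)) > 0"
      using nz i by (simp add: zero_less_measure_iff add.commute)
  qed (use J A p n in auto)
  moreover have "(\<Union>k<n. A (?r k)) = (\<Union>k<n. A k)"
    using r by (metis bij_betw_imp_surj_on image_image)
  ultimately show False using null by (simp add: avoid_def)
qed

text \<open>If the events covered almost everything, adjacent ones would be almost disjoint and have
  separators \<open>S k\<close>. By \<open>disj2\<close> these use pairwise disjoint sets of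
  coordinates, so they hold simultaneously with positive probability; yet their intersection lies in
  a null set.\<close>

lemma cycle_determined_pos:
  assumes J: "\<And>k. k < n \<Longrightarrow> J k \<subseteq> I" and A: "\<And>k. k < n \<Longrightarrow> determined (J k) (A k)"
    and disj: "\<And>a b. a < n \<Longrightarrow> b < n \<Longrightarrow> a \<noteq> b \<Longrightarrow> b \<noteq> (a + 1) mod n \<Longrightarrow> a \<noteq> (b + 1) mod n \<Longrightarrow>
      J a \<inter> J b = {}"
    and disj2: "\<And>a b. a < b \<Longrightarrow> b < n \<Longrightarrow> J a \<inter> J ((a + 1) mod n) \<inter> (J b \<inter> J ((b + 1) mod n)) = {}"
    and p: "\<And>k. k < n \<Longrightarrow> prob (A k) = p" and sp: "shearer_point n p f"
  shows "prob (avoid A {..<n}) > 0"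
proof (rule ccontr)
  assume "\<not> prob (avoid A {..<n}) > 0"
  hence null: "prob (avoid A {..<n}) = 0" by (simp add: zero_less_measure_iff)
  have n: "n > 1" and p0: "p > 0" using sp by (auto simp: shearer_point_def)
  define s where "s k = (k + 1) mod n" for k
  have s: "s k < n" for k using n by (simp add: s_def)
  let ?L = "\<lambda>k. J k \<inter> J (s k)"
  have "\<exists>S. determined (?L k) S \<and> prob S > 0 \<and> prob (S \<inter> A (s k)) = 0" if k: "k < n" for k
  proof -
    have "prob (A k \<inter> A (s k)) = 0"
      unfolding s_def by (rule cycle_determined_adjacent_null[OF J A disj p sp null k])
    then obtain S where "determined (?L k) S" "prob (A k) \<le> prob S" "prob (S \<inter> A (s k)) = 0"
      using determined_separate[OF J[OF k] J[OF s] A[OF k] A[OF s]] by blast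
    thus ?thesis using p[OF k] p0 by (intro exI[of _ S]) simp
  qed
  then obtain S where S: "\<And>k. k < n \<Longrightarrow> determined (?L k) (S k)" "\<And>k. k < n \<Longrightarrow> prob (S k) > 0"
      "\<And>k. k < n \<Longrightarrow> prob (S k \<inter> A (s k)) = 0" by metis
  \<comment> \<open>Intersecting with the space makes \<open>C 0\<close> the whole space, where the
    induction starts.\<close>
  define C where "C m = space (Pi\<^sub>M I M) \<inter> (\<Inter>k<m. S k)" for m
  have C: "determined (\<Union>k<m. ?L k) (C m) \<and> prob (C m) > 0" if "m \<le> n" for m
    using that
  proof (induction m)
    case 0
    show ?case using determined_space by (simp add: C_def P.prob_space)
  next
    case (Suc m)
    hence IH: "determined (\<Union>k<m. ?L k) (C m)" "prob (C m) > 0" and m: "m < n" by auto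
    have C: "C (Suc m) = C m \<inter> S m" by (auto simp: C_def lessThan_Suc)
    have "(\<Union>k<m. ?L k) \<inter> ?L m = {}"
      using disj2 m unfolding s_def by blast
    moreover have "(\<Union>k<m. ?L k) \<subseteq> I"
    proof (rule UN_least)
      fix k assume "k \<in> {..<m}"
      thus "?L k \<subseteq> I" using J[of k] m by auto
    qed
    moreover have "?L m \<subseteq> I" using J[OF m] by auto
    ultimately have "prob (C (Suc m)) = prob (C m) * prob (S m)"
      unfolding C by (intro determined_indep[OF _ _ _ IH(1) S(1)[OF m]])
    moreover have "determined (\<Union>k<Suc m. ?L k) (C (Suc m))"
      using determined_Int[OF IH(1) S(1)[OF m]] unfolding C by (simp add: lessThan_Suc Un_commute)
    ultimately show ?case using IH(2) S(2)[OF m] by simp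
  qed
  have ev: "A k \<in> events" "S k \<in> events" if "k < n" for k
    using that A S(1) by (auto intro: determined_sets)
  \<comment> \<open>If \<open>A j\<close> occurs at a point of \<open>C n\<close>, the separator at
    the cyclic predecessor of \<open>j\<close> holds there too, and that separator meets
    \<open>A j\<close> in a null set.\<close>
  have "C n \<subseteq> avoid A {..<n} \<union> (\<Union>k<n. S k \<inter> A (s k))"
  proof
    fix x assume x: "x \<in> C n"
    show "x \<in> avoid A {..<n} \<union> (\<Union>k<n. S k \<inter> A (s k))"
    proof (cases "x \<in> avoid A {..<n}")
      case False
      then obtain j where j: "j < n" "x \<in> A j" using x by (auto simp: avoid_def C_def)
      have "j \<in> s ` {..<n}"
        using bij_betw_rotate_mod[of n 1] n j(1) by (simp add: bij_betw_def s_def)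
      thus ?thesis using j x by (auto simp: C_def)
    qed simp
  qed
  hence "prob (C n) \<le> prob (avoid A {..<n} \<union> (\<Union>k<n. S k \<inter> A (s k)))"
    using ev s by (intro finite_measure_mono) (auto intro!: sets.Un avoid_sets)
  also have "\<dots> \<le> prob (avoid A {..<n}) + prob (\<Union>k<n. S k \<inter> A (s k))"
    using ev s by (intro measure_Un_le) (auto intro!: avoid_sets)
  also have "prob (\<Union>k<n. S k \<inter> A (s k)) \<le> (\<Sum>k<n. prob (S k \<inter> A (s k)))"
    using ev s by (intro finite_measure_subadditive_finite) auto
  also have "\<dots> = 0" using S(3) by simp
  finally show False using C[of n] null by simp
qed

end

section \<open>Conforming families\<close>

lemma prob_space_unit_lborel: "prob_space unit_lborel"
  by (rule prob_spaceI) (simp add: emeasure_restrict_space space_restrict_space)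

lemma finite_product_unit: "finite I \<Longrightarrow> finite_product_prob_space (\<lambda>_. unit_lborel) I"
  by (intro finite_product_prob_space.intro product_prob_spaceI finite_product_sigma_finite.intro
      finite_product_sigma_finite_axioms.intro prob_space_unit_lborel
      product_prob_space.axioms(1)[OF product_prob_spaceI[OF prob_space_unit_lborel]])

text \<open>Left vertices with a common neighbour are pairwise adjacent. Two different edges of the
  cycle cover at least three vertices, so a right vertex adjacent to all of them would create a
  triangle; this forces \<open>n = 3\<close>, where \<open>tri\<close> excludes it.\<close>

lemma cycle_order_common_neighbour:
  assumes c: "cycle_order n (base_graph n E) \<sigma>" and E: "bigraph n m E"
    and tri: "n = 3 \<longrightarrow> (\<Inter>i\<in>{1..n}. left_nbhd E i) = {}"
    and ab: "a < b" "b < n"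
  defines "J \<equiv> \<lambda>k. left_nbhd E (\<sigma> k)"
  shows "J a \<inter> J ((a + 1) mod n) \<inter> (J b \<inter> J ((b + 1) mod n)) = {}"
proof (rule ccontr)
  assume "J a \<inter> J ((a + 1) mod n) \<inter> (J b \<inter> J ((b + 1) mod n)) \<noteq> {}"
  \<comment> \<open>Since \<open>a < b\<close> and \<open>b < n\<close>, only \<open>b + 1\<close>
    can wrap around to 0.\<close>
  then obtain j where j: "j \<in> J a" "j \<in> J (a + 1)" "j \<in> J b" "j \<in> J ((b + 1) mod n)" using ab by auto
  have n: "n \<ge> 3" and im: "\<sigma> ` {..<n} = {1..n}" using c by (auto simp: cycle_order_def bij_betw_def)
  have adj: "y = x + 1 \<or> x = 0 \<and> y = n - 1" if "x < y" "y < n" "j \<in> J x" "j \<in> J y" for x y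
  proof -
    have "\<sigma> x \<in> {1..n}" "\<sigma> y \<in> {1..n}" "\<sigma> x \<noteq> \<sigma> y"
      using that im cycle_order_inj[OF c, of x y] by auto
    hence "{\<sigma> x, \<sigma> y} \<in> base_graph n E" using that unfolding base_graph_def J_def by blast
    thus ?thesis using cycle_order_edge_less_iff[OF c that(1,2)] by simp
  qed
  have "n = 3 \<and> j \<in> J 0 \<and> j \<in> J 1 \<and> j \<in> J 2"
  proof (cases "b + 1 = n")
    case True
    hence "j \<in> J 0" using j by simp
    show ?thesis
    proof (cases "a = 0")
      case True
      have "b = 2" using adj[of 1 b] j True \<open>b + 1 = n\<close> n by auto
      thus ?thesis using j True \<open>b + 1 = n\<close> by simp
    next
      case False
      have "a = 1" using adj[of 0 a] j \<open>j \<in> J 0\<close> False \<open>b + 1 = n\<close> ab by auto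
      moreover have "b = 2" using adj[of 1 b] j \<open>a = 1\<close> ab by auto
      ultimately show ?thesis using j \<open>j \<in> J 0\<close> \<open>b + 1 = n\<close> by (auto simp: numeral_2_eq_2)
    qed
  next
    case False
    hence "j \<in> J (b + 1)" "b + 1 < n" using j ab by auto
    hence "a = 0" "b + 1 = n - 1" using adj[of a "b + 1"] j ab by auto
    moreover from this have "b = 1" using adj[of a b] j ab by auto
    ultimately show ?thesis using j \<open>j \<in> J (b + 1)\<close> by (auto simp: numeral_2_eq_2)
  qed
  hence n3: "n = 3" and "\<forall>k<n. j \<in> J k" by (auto simp: numeral_3_eq_3 less_Suc_eq numeral_2_eq_2)
  hence "j \<in> (\<Inter>i\<in>\<sigma> ` {..<n}. left_nbhd E i)" by (auto simp: J_def)
  thus False unfolding im using tri n3 by blast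
qed

text \<open>A set in the completion is a product-measurable set together with a subset of a null
  set, and cylinders preserve this. It leads back to the uncompleted product, in which
  \<open>determined\<close> is formulated.\<close>

lemma conforms_inner_approximation:
  assumes "A = prod_emb {1..m} (\<lambda>_. unit_lborel) J B" "B \<in> sets (unit_cube J)" "J \<subseteq> {1..m}"
  obtains A' N where "finite_product_prob_space.determined (\<lambda>_. unit_lborel) {1..m} J A'"
    "N \<in> null_sets (Pi\<^sub>M {1..m} (\<lambda>_. unit_lborel))" "A' \<subseteq> A" "A \<subseteq> A' \<union> N"
proof -
  let ?M = "\<lambda>_::nat. unit_lborel" let ?P = "Pi\<^sub>M {1..m} ?M"
  interpret finite_product_prob_space ?M "{1..m}" by (rule finite_product_unit) simp
  have fJ: "finite J" using assms(3) finite_subset by auto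
  obtain S N N' where S: "B = S \<union> N" "N \<subseteq> N'" "N' \<in> null_sets (Pi\<^sub>M J ?M)" "S \<in> sets (Pi\<^sub>M J ?M)"
    using assms(2) unfolding unit_cube_def by (rule sets_completionE)
  let ?e = "prod_emb {1..m} ?M J"
  show ?thesis
  proof (rule that[of "?e S" "?e N'"])
    show "determined J (?e S)"
      unfolding determined_def
    proof (intro conjI ballI impI)
      show "?e S \<in> events" using S assms(3) by simp
      fix x y assume "x \<in> space ?P" "y \<in> space ?P" "\<forall>j\<in>J. x j = y j" "x \<in> ?e S"
      moreover from this have "restrict x J = restrict y J" by auto
      ultimately show "y \<in> ?e S" by (simp add: prod_emb_def space_PiM)
    qed
    show "?e N' \<in> null_sets ?P"
      using S assms(3) fJ emeasure_PiM_emb'[of J N'] by (auto simp: null_sets_def)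
    show "?e S \<subseteq> A" "A \<subseteq> ?e S \<union> ?e N'" using S assms(1) by (auto simp: prod_emb_def)
  qed
qed

text \<open>Inner approximation changes each event only on a null set, so
  \<open>cycle_determined_pos\<close> applies with the neighbourhoods as coordinate sets.
  Nonadjacent vertices have disjoint neighbourhoods by the definition of \<open>base_graph\<close>,
  and different edges have no common neighbour by
  \<open>cycle_order_common_neighbour\<close>.\<close>

lemma shearer_point_in_interior_bigraph:
  assumes c: "cycle_order n (base_graph n E) \<sigma>" and E: "bigraph n m E"
    and tri: "n = 3 \<longrightarrow> (\<Inter>i\<in>{1..n}. left_nbhd E i) = {}" and sp: "shearer_point n p f"
  shows "(\<lambda>i. p) \<in> interior_bigraph n m E"
proof -
  let ?M = "\<lambda>_::nat. unit_lborel" let ?P = "Pi\<^sub>M {1..m} ?M"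
  interpret finite_product_prob_space ?M "{1..m}" by (rule finite_product_unit) simp
  have bij: "bij_betw \<sigma> {..<n} {1..n}" using c by (simp add: cycle_order_def)
  hence im: "\<sigma> ` {..<n} = {1..n}" by (simp add: bij_betw_def)
  have J: "left_nbhd E i \<subseteq> {1..m}" for i using E by (auto simp: bigraph_def left_nbhd_def)
  have "measure (unit_cube {1..m}) (space (unit_cube {1..m}) - (\<Union>i\<in>{1..n}. A i)) > 0"
    if A: "conforms n m E A" "\<forall>i\<in>{1..n}. measure (unit_cube {1..m}) (A i) = p" for A
  proof -
    have "\<exists>A' N. determined (left_nbhd E i) A' \<and> N \<in> null_sets ?P \<and> A' \<subseteq> A i \<and> A i \<subseteq> A' \<union> N"
      if i: "i \<in> {1..n}" for i
    proof -
      obtain B where "B \<in> sets (unit_cube (left_nbhd E i))"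
          "A i = prod_emb {1..m} ?M (left_nbhd E i) B"
        using A(1) i unfolding conforms_def by blast
      thus ?thesis using conforms_inner_approximation[OF _ _ J] by metis
    qed
    then obtain A' N where A': "\<And>i. i \<in> {1..n} \<Longrightarrow> determined (left_nbhd E i) (A' i)"
      and N: "\<And>i. i \<in> {1..n} \<Longrightarrow> N i \<in> null_sets ?P"
      and AA': "\<And>i. i \<in> {1..n} \<Longrightarrow> A' i \<subseteq> A i \<and> A i \<subseteq> A' i \<union> N i" by metis
    have A's: "A' i \<in> events" if "i \<in> {1..n}" for i using A'[OF that] by (rule determined_sets)
    have As: "A i \<in> sets (completion ?P)" if "i \<in> {1..n}" for i
    proof (rule sets_completionI)
      show "A i = A' i \<union> (A i - A' i)" "A i - A' i \<subseteq> N i" using AA'[OF that] by auto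
    qed (use N A's that in auto)
    have AE: "AE x in ?P. x \<in> A' i \<longleftrightarrow> x \<in> A i" if i: "i \<in> {1..n}" for i
      using AE_not_in[OF N[OF i]] by eventually_elim (use AA'[OF i] in auto)
    have pA': "prob (A' i) = p" if i: "i \<in> {1..n}" for i
    proof -
      have "measure (completion ?P) (A' i) = measure (completion ?P) (A i)"
        using AE_completion[OF AE[OF i]] A's[OF i] As[OF i] by (intro measure_eq_AE) auto
      thus ?thesis using A(2) i A's[OF i] by (simp add: unit_cube_def)
    qed
    have sn: "\<sigma> k \<in> {1..n}" if "k < n" for k using that im by auto
    have "prob (avoid (\<lambda>k. A' (\<sigma> k)) {..<n}) > 0"
    proof (rule cycle_determined_pos[where J = "\<lambda>k. left_nbhd E (\<sigma> k)", OF _ _ _ _ _ sp])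
      fix a b assume ab: "a < n" "b < n" "a \<noteq> b" "b \<noteq> (a + 1) mod n" "a \<noteq> (b + 1) mod n"
      hence "{\<sigma> a, \<sigma> b} \<notin> base_graph n E" using cycle_order_edge_iff[OF c ab(1,2)] by simp
      moreover have "\<sigma> a \<noteq> \<sigma> b" using cycle_order_inj[OF c ab(1,2)] ab(3) by simp
      ultimately show "left_nbhd E (\<sigma> a) \<inter> left_nbhd E (\<sigma> b) = {}"
        using sn[OF ab(1)] sn[OF ab(2)] unfolding base_graph_def by blast
    next
      fix a b assume "a < b" "b < n"
      thus "left_nbhd E (\<sigma> a) \<inter> left_nbhd E (\<sigma> ((a + 1) mod n)) \<inter>
          (left_nbhd E (\<sigma> b) \<inter> left_nbhd E (\<sigma> ((b + 1) mod n))) = {}"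
        by (rule cycle_order_common_neighbour[OF c E tri])
    qed (use J A' pA' sn in auto)
    also have "avoid (\<lambda>k. A' (\<sigma> k)) {..<n} = space ?P - (\<Union>i\<in>{1..n}. A' i)"
      unfolding P.avoid_def im[symmetric] by simp
    also have "prob \<dots> = measure (completion ?P) (space ?P - (\<Union>i\<in>{1..n}. A' i))"
      using A's by (intro measure_completion[symmetric] sets.Diff sets.top sets.finite_UN) auto
    also have "\<dots> = measure (completion ?P) (space ?P - (\<Union>i\<in>{1..n}. A i))"
    proof (rule measure_eq_AE)
      have "AE x in ?P. \<forall>i\<in>{1..n}. x \<in> A' i \<longleftrightarrow> x \<in> A i"
        using AE by (intro AE_finite_allI) auto
      hence "AE x in ?P. x \<in> space ?P - (\<Union>i\<in>{1..n}. A' i) \<longleftrightarrow>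
          x \<in> space ?P - (\<Union>i\<in>{1..n}. A i)"
        by eventually_elim auto
      thus "AE x in completion ?P. x \<in> space ?P - (\<Union>i\<in>{1..n}. A' i) \<longleftrightarrow>
          x \<in> space ?P - (\<Union>i\<in>{1..n}. A i)"
        by (rule AE_completion)
      have top: "space ?P \<in> sets (completion ?P)" by auto
      show "space ?P - (\<Union>i\<in>{1..n}. A' i) \<in> sets (completion ?P)"
        using A's top by (intro sets.Diff sets.finite_UN) auto
      show "space ?P - (\<Union>i\<in>{1..n}. A i) \<in> sets (completion ?P)"
        using As top by (intro sets.Diff sets.finite_UN) auto
    qed
    finally show ?thesis by (simp add: unit_cube_def)
  qed
  moreover have "0 < p" "p < 1" using sp by (auto simp: shearer_point_def)
  ultimately show ?thesis unfolding interior_bigraph_def by auto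
qed

theorem theorem7:
  fixes n m :: nat and E :: "(nat \<times> nat) set"
  assumes "cyclic_bigraph n m E"
  shows "gapful n m E"
proof -
  obtain \<sigma> where c: "cycle_order n (base_graph n E) \<sigma>"
    using assms by (auto simp: cyclic_bigraph_def is_cycle_graph_iff_cycle_order)
  hence "n \<ge> 3" by (simp add: cycle_order_def)
  then obtain p f where sp: "shearer_point n p f" using shearer_point_exists by blast
  have "(\<lambda>i. p) \<in> interior_bigraph n m E"
    using assms by (intro shearer_point_in_interior_bigraph[OF c _ _ sp]) (auto simp: cyclic_bigraph_def)
  moreover have "(\<lambda>i. p) \<notin> abstract_interior n (base_graph n E)"
    by (rule shearer_point_notin_abstract_interior[OF c sp])
  \<comment> \<open>The constant vector \<open>p\<close> already lies in the gap, so the scaling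
    factor is 1.\<close>
  ultimately have "gapful_in_direction n m E (\<lambda>i. p)"
    unfolding gapful_in_direction_def using sp
    by (auto simp: shearer_point_def intro!: exI[of _ 1])
  thus ?thesis by (auto simp: gapful_def)
qed

end
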